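(* The 3-dimensional Cohn-Elkies linear programming bound (i.e., the Cohn-Elkies linear programming bound in $\mathbb{R}^3$) is greater than $0.18398089$.
   Context: Fourier transform on $\mathbb{R}^d$: $\widehat f(y)=\int_{\mathbb{R}^d} f(x)e^{-2\pi i\langle x,y\rangle}\,dx$, where $\langle x,y\rangle=x_1y_1+\cdots+x_dy_d$. A function $f:\mathbb{R}^d\to\mathbb{R}$ is rapidly decreasing if $f(x)=O\left((1+|x|)^{-k}\right)$ for all positive integers $k$; it is radial if $f(x)$ depends only on $|x|$. For fixed $r>0$ and positive integer $d$, the Cohn-Elkies linear programming bound in $\mathbb{R}^d$ is the infimum of $\left(\frac r2\right)^d f(0)$ over all radial, smooth, rapidly decreasing functions $f:\mathbb{R}^d\to\mathbb{R}$ such that $f(0)>0$; $\widehat f(0)\geq 1$; $f(x)\leq 0$ for all $|x|\geq r$; and $\widehat f(y)\geq 0$ for all $y\in\mathbb{R}^d$. This value does not depend on $r$ (by rescaling $f$). *)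

theory Defs
  imports "HOL-Analysis.Analysis"
begin

definition fourier :: "(real ^ 'n \<Rightarrow> real) \<Rightarrow> real ^ 'n \<Rightarrow> complex" where
  "fourier f y = (\<integral>x. complex_of_real (f x) * exp (- 2 * complex_of_real pi * \<i> * complex_of_real (x \<bullet> y)) \<partial>lborel)"

text \<open>\<open>Ck k f\<close>: f is k times continuously differentiable. In the step case, \<open>f' x\<close> is the total
  derivative at x, and each directional derivative \<open>\<lambda>x. f' x v\<close> must be of class \<open>C\<^sup>k\<close>.\<close>

fun Ck :: "nat \<Rightarrow> (real ^ 'n \<Rightarrow> real) \<Rightarrow> bool" where
  "Ck 0 f = continuous_on UNIV f"
| "Ck (Suc k) f =
    (\<exists>f'. (\<forall>x. (f has_derivative f' x) (at x)) \<and> (\<forall>v. Ck k (\<lambda>x. f' x v)))"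

definition smooth :: "(real ^ 'n \<Rightarrow> real) \<Rightarrow> bool" where
  "smooth f \<longleftrightarrow> (\<forall>k. Ck k f)"

definition rapidly_decreasing :: "(real ^ 'n \<Rightarrow> real) \<Rightarrow> bool" where
  "rapidly_decreasing f \<longleftrightarrow> (\<forall>k::nat. k > 0 \<longrightarrow> (\<exists>C. \<forall>x. \<bar>f x\<bar> \<le> C / (1 + norm x) ^ k))"

definition radial :: "(real ^ 'n \<Rightarrow> real) \<Rightarrow> bool" where
  "radial f \<longleftrightarrow> (\<forall>x y. norm x = norm y \<longrightarrow> f x = f y)"

text \<open>The transform of a real radial function is real; since \<^const>\<open>fourier\<close> is complex-valued, this is
  spelled out as membership in \<open>\<real>\<close>, and the inequalities are stated for the real part.\<close>

definition cohn_elkies_admissible :: "real \<Rightarrow> (real ^ 'n \<Rightarrow> real) \<Rightarrow> bool" where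
  "cohn_elkies_admissible r f \<longleftrightarrow>
     radial f \<and> smooth f \<and> rapidly_decreasing f \<and>
     f 0 > 0 \<and>
     fourier f 0 \<in> \<real> \<and> Re (fourier f 0) \<ge> 1 \<and>
     (\<forall>x. norm x \<ge> r \<longrightarrow> f x \<le> 0) \<and>
     (\<forall>y. fourier f y \<in> \<real> \<and> Re (fourier f y) \<ge> 0)"

text \<open>The infimum is taken in the extended reals, so that it is meaningful without knowing
  in advance that admissible functions exist. The dimension is \<open>CARD('n)\<close>.\<close>

definition cohn_elkies_bound :: "'n::finite itself \<Rightarrow> real \<Rightarrow> ereal" where
  "cohn_elkies_bound _ r =
     (INF f \<in> {f :: real ^ 'n \<Rightarrow> real. cohn_elkies_admissible r f}. ereal ((r / 2) ^ CARD('n) * f 0))"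

end

theory Submission
  imports Defs "HOL-Probability.Probability" "HOL-Real_Asymp.Real_Asymp"
begin

text \<open>The bound is proved by linear programming duality: a positive measure on \<open>\<real>\<^sup>3\<close> that has a unit mass at the origin, is otherwise
supported where every admissible \<open>f\<close> is nonpositive, and has a nonnegative Fourier transform with a mass \<open>c\<close> at the origin.
Integrating \<open>f\<close> against the measure gives at most \<open>f(0)\<close>; integrating the Fourier transform of \<open>f\<close> against the
transformed measure gives at least \<open>c\<close> times its value at \<open>0\<close>. Hence \<open>f(0) \<ge> c\<close>.

The measure is radial. In three dimensions the radial Fourier transform is a sine transform: if \<open>F\<close> is the profile of \<open>f\<close>, then
the Fourier transform of \<open>f\<close> at radius \<open>x / 2\<pi>\<close> is a positive multiple of \<open>T(x) / x\<close> with \<open>T(x) = \<integral> t F(t) sin (x t) dt\<close>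
(\<open>fourier_axis_radial\<close>, from the hat-box theorem \<open>distr_norm_coordinate\<close>). So the whole problem lives on the line. After
rescaling to \<open>r = 1\<close>, the measure consists of the unit mass, two spherical shells of radii \<open>1\<close> and \<open>1.56\<close>, and beyond
radius \<open>1.56\<close> a density proportional to \<open>q(t) / t\<close> with \<open>q(t) = t + 1.63 sin (8.18 t) + 0.965 sin (13.105 t)\<close>. Its transform is
a mass at the origin, two spherical shells, and the function \<open>H(x) / x\<close>, where \<open>H\<close> is an explicit combination of sines and of the sine
transform of \<open>q\<close> restricted to \<open>[0, 1.56]\<close>. The oscillating terms of \<open>q\<close> imitate the first two shells of the optimal dual
measure in frequency; they allow the tail to start early.

Two positivity statements carry the proof. That \<open>q\<close> is nonnegative beyond \<open>1.56\<close> is elementary (\<open>tail_weight_nonneg\<close>). That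
\<open>H\<close> is nonnegative on the positive axis (\<open>dual_transform_nonneg\<close>) is numerical: \<open>H\<close> has frequencies at most \<open>1.56\<close>, so
between the nodes of a grid it differs little from its chords; the values at the nodes are bounded below in integer arithmetic, with
sines and cosines obtained by repeated multiplication of complex numbers; and beyond \<open>24\<close> the linear term of \<open>H\<close> dominates.

The Fourier transform of \<open>f\<close> is not known to be integrable in advance, and \<open>f\<close> is not known to have decaying derivatives. Therefore
\<open>radial_dual_certificate\<close> pairs \<open>T\<close> with \<open>H\<close> under a Gaussian weight, where every interchange of integrals is justified, and then lets
the weight tend to one.\<close>

section \<open>Integrals of radial functions over three-space\<close>

lemma borel_measurable_vector3:
  "(\<lambda>(a, w). vector [a, fst w, snd w] :: real^3) \<in> borel_measurable (lborel \<Otimes>\<^sub>M lborel)"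
proof -
  have "(\<lambda>(a, w). vector [a, fst w, snd w] :: real^3)
      = (\<lambda>p. fst p *\<^sub>R axis 1 1 + fst (snd p) *\<^sub>R axis 2 1 + snd (snd p) *\<^sub>R axis 3 1)"
    by (auto simp: fun_eq_iff vec_eq_iff forall_3 vector_3 axis_def)
  moreover have "continuous_on UNIV (\<lambda>p :: real \<times> (real \<times> real).
      fst p *\<^sub>R axis 1 1 + fst (snd p) *\<^sub>R axis 2 1 + snd (snd p) *\<^sub>R axis 3 1 :: real^3)"
    by (intro continuous_intros)
  ultimately show ?thesis
    by (simp add: lborel_prod borel_measurable_continuous_onI)
qed

lemma lborel_eq_distr_vector3:
  "(lborel :: (real^3) measure) =
     distr (lborel \<Otimes>\<^sub>M lborel) borel (\<lambda>(a, u). vector [a, fst u, snd u] :: real^3)"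
proof (rule lborel_eqI)
  fix l u :: "real^3"
  assume le: "\<And>b. b \<in> Basis \<Longrightarrow> l \<bullet> b \<le> u \<bullet> b"
  have le': "l $ i \<le> u $ i" for i
    using le[of "axis i 1"] by (auto simp: inner_axis Basis_vec_def)
  note borel_measurable_vector3 [measurable]
  have eq: "(\<lambda>(a, w). vector [a, fst w, snd w] :: real^3) -` box l u \<inter> space (lborel \<Otimes>\<^sub>M lborel)
      = {l$1<..<u$1} \<times> ({l$2<..<u$2} \<times> {l$3<..<u$3})"
    by (auto simp: mem_box_cart forall_3 vector_3 space_pair_measure)
  have "emeasure (distr (lborel \<Otimes>\<^sub>M lborel) borel (\<lambda>(a, w). vector [a, fst w, snd w] :: real^3)) (box l u)
     = emeasure (lborel \<Otimes>\<^sub>M lborel) ({l$1<..<u$1} \<times> ({l$2<..<u$2} \<times> {l$3<..<u$3}))"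
    by (subst emeasure_distr) (auto simp: eq)
  also have "\<dots> = emeasure lborel {l$1<..<u$1} * emeasure lborel ({l$2<..<u$2} \<times> {l$3<..<u$3})"
    by (rule lborel.emeasure_pair_measure_Times) (auto simp: borel_prod[symmetric])
  also have "emeasure lborel ({l$2<..<u$2} \<times> {l$3<..<u$3}) = emeasure lborel {l$2<..<u$2} * emeasure lborel {l$3<..<u$3}"
    by (subst lborel_prod[symmetric], rule lborel.emeasure_pair_measure_Times) auto
  also have "emeasure lborel {l$1<..<u$1} * \<dots> = ennreal ((u$1 - l$1) * ((u$2 - l$2) * (u$3 - l$3)))"
    using le' by (simp add: ennreal_mult' mult_nonneg_nonneg)
  also have "(u$1 - l$1) * ((u$2 - l$2) * (u$3 - l$3)) = (\<Prod>b\<in>Basis. (u - l) \<bullet> b)"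
  proof -
    have B: "(Basis :: (real^3) set) = (\<lambda>i. axis i 1) ` UNIV"
      by (auto simp: Basis_vec_def)
    have "(\<Prod>b\<in>(Basis :: (real^3) set). (u - l) \<bullet> b) = (\<Prod>i\<in>UNIV. (u - l) $ i)"
      unfolding B by (subst prod.reindex) (auto simp: inj_on_def axis_eq_axis inner_axis)
    then show ?thesis unfolding UNIV_3 by (simp add: mult.assoc)
  qed
  finally show "emeasure (distr (lborel \<Otimes>\<^sub>M lborel) borel (\<lambda>(a, w). vector [a, fst w, snd w] :: real^3)) (box l u) =
      ennreal (\<Prod>b\<in>Basis. (u - l) \<bullet> b)" .
qed simp

text \<open>Fix the first coordinate \<open>a\<close> of a point of three-space. The remaining two coordinates run through a plane, and the
points of that plane with distance at most \<open>s\<close> from the origin form a disc of area \<open>\<pi> (s\<^sup>2 - a\<^sup>2)\<close>. Its derivative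
\<open>2 \<pi> s\<close> does not involve \<open>a\<close>; this is Archimedes' hat-box theorem, and the reason why radial Fourier transforms
in dimension three reduce to sine transforms.\<close>

lemma distr_plane_distance:
  fixes a :: real
  shows "distr (lborel :: (real \<times> real) measure) borel (\<lambda>u. sqrt (a\<^sup>2 + (norm u)\<^sup>2))
    = density lborel (\<lambda>\<rho>. ennreal (2 * pi * \<rho>) * indicator {\<bar>a\<bar>..} \<rho>)"
    (is "?M = ?N")
proof (rule measure_eqI_generator_eq[where E = "range atMost" and \<Omega> = UNIV and A = "\<lambda>i. {..real i}"])
  show "Int_stable (range atMost :: real set set)"
    by (auto simp: Int_stable_def)
  show "sets ?M = sigma_sets UNIV (range atMost)" "sets ?N = sigma_sets UNIV (range atMost)"
    by (simp_all add: borel_eq_atMost)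
  show "(\<Union>i. {..real i}) = UNIV"
    by (auto intro: real_arch_simple)
  have M: "emeasure ?M {..s} = (if \<bar>a\<bar> \<le> s then ennreal (pi * (s\<^sup>2 - a\<^sup>2)) else 0)" for s
  proof -
    have "emeasure ?M {..s} = emeasure lborel ((\<lambda>u :: real \<times> real. sqrt (a\<^sup>2 + (norm u)\<^sup>2)) -` {..s})"
      by (subst emeasure_distr) auto
    also have "\<dots> = (if \<bar>a\<bar> \<le> s then ennreal (pi * (s\<^sup>2 - a\<^sup>2)) else 0)"
    proof (cases "\<bar>a\<bar> \<le> s")
      case True
      then have sq: "a\<^sup>2 \<le> s\<^sup>2" "s \<ge> 0"
        by (auto simp: abs_le_square_iff[symmetric])
      have "(sqrt (a\<^sup>2 + (norm u)\<^sup>2) \<le> s) = (norm u \<le> sqrt (s\<^sup>2 - a\<^sup>2))" for u :: "real \<times> real"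
      proof
        assume "sqrt (a\<^sup>2 + (norm u)\<^sup>2) \<le> s"
        then have "a\<^sup>2 + (norm u)\<^sup>2 \<le> s\<^sup>2" by (rule sqrt_le_D)
        then show "norm u \<le> sqrt (s\<^sup>2 - a\<^sup>2)" by (intro real_le_rsqrt) simp
      next
        assume "norm u \<le> sqrt (s\<^sup>2 - a\<^sup>2)"
        then have "(norm u)\<^sup>2 \<le> (sqrt (s\<^sup>2 - a\<^sup>2))\<^sup>2" by (rule power_mono) simp
        then show "sqrt (a\<^sup>2 + (norm u)\<^sup>2) \<le> s" using sq by (intro real_le_lsqrt) auto
      qed
      then have "(\<lambda>u :: real \<times> real. sqrt (a\<^sup>2 + (norm u)\<^sup>2)) -` {..s} = cball 0 (sqrt (s\<^sup>2 - a\<^sup>2))"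
        by (auto simp: cball_def dist_norm)
      then show ?thesis
        using True sq by (simp add: emeasure_cball unit_ball_vol_2)
    next
      case False
      have "\<bar>a\<bar> \<le> sqrt (a\<^sup>2 + (norm u)\<^sup>2)" for u :: "real \<times> real"
        by (rule real_le_rsqrt) simp
      then have "\<not> sqrt (a\<^sup>2 + (norm u)\<^sup>2) \<le> s" for u :: "real \<times> real"
        using False by (metis order_trans)
      then have "(\<lambda>u :: real \<times> real. sqrt (a\<^sup>2 + (norm u)\<^sup>2)) -` {..s} = {}"
        by blast
      then show ?thesis using False by simp
    qed
    finally show ?thesis .
  qed
  have N: "emeasure ?N {..s} = (if \<bar>a\<bar> \<le> s then ennreal (pi * (s\<^sup>2 - a\<^sup>2)) else 0)" for s
  proof -
    have "emeasure ?N {..s} = (\<integral>\<^sup>+\<rho>. ennreal (2 * pi * \<rho>) * indicator {\<bar>a\<bar>..s} \<rho> \<partial>lborel)"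
      by (subst emeasure_density) (auto intro!: nn_integral_cong split: split_indicator)
    also have "\<dots> = (if \<bar>a\<bar> \<le> s then ennreal (pi * (s\<^sup>2 - a\<^sup>2)) else 0)"
    proof (cases "\<bar>a\<bar> \<le> s")
      case True
      have "(\<integral>\<^sup>+\<rho>. ennreal (2 * pi * \<rho>) * indicator {\<bar>a\<bar>..s} \<rho> \<partial>lborel) = ennreal (pi * s\<^sup>2 - pi * \<bar>a\<bar>\<^sup>2)"
        by (rule nn_integral_FTC_Icc) (use True in \<open>auto intro!: derivative_eq_intros\<close>)
      then show ?thesis using True by (simp add: right_diff_distrib)
    qed simp
    finally show ?thesis .
  qed
  show "emeasure ?M X = emeasure ?N X" if "X \<in> range atMost" for X
    using that M N by auto
  show "emeasure ?M {..real i} \<noteq> \<infinity>" for i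
    by (simp add: M)
qed (auto simp: image_subset_iff)

lemma borel_measurable_cone_indicator:
  "(\<lambda>p :: real \<times> real. c * fst p * indicator {-fst p..fst p} (snd p) :: real)
     \<in> borel_measurable (lborel \<Otimes>\<^sub>M lborel)"
proof -
  have "closed {p :: real \<times> real. - fst p \<le> snd p \<and> snd p \<le> fst p}"
    by (intro closed_Collect_conj closed_Collect_le continuous_intros)
  then have ind: "(indicator {p :: real \<times> real. - fst p \<le> snd p \<and> snd p \<le> fst p} :: _ \<Rightarrow> real) \<in> borel_measurable borel"
    by (intro borel_measurable_indicator borel_closed)
  have "(\<lambda>p. c * fst p * indicator {p :: real \<times> real. - fst p \<le> snd p \<and> snd p \<le> fst p} p :: real) \<in> borel_measurable borel"
    by (rule borel_measurable_times[OF borel_measurable_continuous_onI ind]) (intro continuous_intros)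
  then show ?thesis
    by (simp add: lborel_prod indicator_def)
qed

text \<open>The joint distribution of the distance from the origin and one coordinate determines all integrals of the form
\<open>\<integral> F |x| k(x\<^sub>1)\<close>, in particular the Fourier transform of a radial function along an axis.\<close>

lemma distr_norm_coordinate:
  "distr (lborel :: (real^3) measure) (borel \<Otimes>\<^sub>M borel) (\<lambda>x. (norm x, x $ 1))
    = density (lborel \<Otimes>\<^sub>M lborel) (\<lambda>(\<rho>, a). ennreal (2 * pi * \<rho> * indicator {-\<rho>..\<rho>} a))"
    (is "?M = ?N")
proof (rule measure_eqI)
  show "sets ?M = sets ?N"
    by (auto intro!: sets_pair_measure_cong)
  have coord [measurable]: "(\<lambda>x :: real^3. x $ 1) \<in> borel_measurable borel"
    by (intro borel_measurable_continuous_onI continuous_intros)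
  have dens [measurable]: "(\<lambda>(\<rho> :: real, a). ennreal (2 * pi * \<rho> * indicator {-\<rho>..\<rho>} a))
      \<in> borel_measurable (lborel \<Otimes>\<^sub>M lborel)"
    unfolding case_prod_unfold by (rule measurable_compose[OF borel_measurable_cone_indicator measurable_ennreal])
  fix A assume "A \<in> sets ?M"
  then have A [measurable]: "A \<in> sets (borel \<Otimes>\<^sub>M borel)"
    by simp
  have nrm: "norm (vector [a, fst u, snd u] :: real^3) = sqrt (a\<^sup>2 + (norm u)\<^sup>2)" for a :: real and u
    by (cases u) (simp add: norm_vec_def L2_set_def sum_3 vector_3 norm_Pair add.assoc)
  note borel_measurable_vector3 [measurable]
  have sq [measurable]: "(\<lambda>(a, u). sqrt (a\<^sup>2 + (norm u)\<^sup>2))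
      \<in> borel_measurable (lborel \<Otimes>\<^sub>M (lborel :: (real \<times> real) measure))"
    by measurable
  have "emeasure ?M A = (\<integral>\<^sup>+x. indicator A (norm x, x $ 1) \<partial>(lborel :: (real^3) measure))"
  proof -
    have "emeasure ?M A = (\<integral>\<^sup>+p. indicator A p \<partial>?M)" by simp
    also have "\<dots> = (\<integral>\<^sup>+x. indicator A (norm x, x $ 1) \<partial>(lborel :: (real^3) measure))"
      by (rule nn_integral_distr) auto
    finally show ?thesis .
  qed
  also have "\<dots> = (\<integral>\<^sup>+p. indicator A (sqrt ((fst p)\<^sup>2 + (norm (snd p))\<^sup>2), fst p)
       \<partial>(lborel \<Otimes>\<^sub>M (lborel :: (real \<times> real) measure)))"
    by (subst lborel_eq_distr_vector3, subst nn_integral_distr)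
       (auto simp: case_prod_unfold nrm vector_3)
  also have "\<dots> = (\<integral>\<^sup>+a. \<integral>\<^sup>+u. indicator A (sqrt (a\<^sup>2 + (norm u)\<^sup>2), a)
       \<partial>(lborel :: (real \<times> real) measure) \<partial>lborel)"
    by (subst lborel.nn_integral_fst[symmetric]) auto
  also have "\<dots> = (\<integral>\<^sup>+a. \<integral>\<^sup>+\<rho>. ennreal (2 * pi * \<rho> * indicator {-\<rho>..\<rho>} a) * indicator A (\<rho>, a)
       \<partial>lborel \<partial>lborel)"
  proof (rule nn_integral_cong)
    fix a :: real
    have "(\<integral>\<^sup>+u. indicator A (sqrt (a\<^sup>2 + (norm u)\<^sup>2), a) \<partial>(lborel :: (real \<times> real) measure))
        = (\<integral>\<^sup>+\<rho>. indicator A (\<rho>, a) \<partial>(distr (lborel :: (real \<times> real) measure) borel (\<lambda>u. sqrt (a\<^sup>2 + (norm u)\<^sup>2))))"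
      by (subst nn_integral_distr) auto
    also have "\<dots> = (\<integral>\<^sup>+\<rho>. ennreal (2 * pi * \<rho>) * indicator {\<bar>a\<bar>..} \<rho> * indicator A (\<rho>, a) \<partial>lborel)"
      unfolding distr_plane_distance by (subst nn_integral_density) auto
    also have "\<dots> = (\<integral>\<^sup>+\<rho>. ennreal (2 * pi * \<rho> * indicator {-\<rho>..\<rho>} a) * indicator A (\<rho>, a) \<partial>lborel)"
      by (intro nn_integral_cong) (auto split: split_indicator)
    finally show "(\<integral>\<^sup>+u. indicator A (sqrt (a\<^sup>2 + (norm u)\<^sup>2), a) \<partial>(lborel :: (real \<times> real) measure))
        = (\<integral>\<^sup>+\<rho>. ennreal (2 * pi * \<rho> * indicator {-\<rho>..\<rho>} a) * indicator A (\<rho>, a) \<partial>lborel)" .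
  qed
  also have "\<dots> = (\<integral>\<^sup>+p. ennreal (2 * pi * fst p * indicator {-fst p..fst p} (snd p)) * indicator A p
       \<partial>(lborel \<Otimes>\<^sub>M lborel))"
    by (subst lborel_pair.nn_integral_snd[symmetric]) (auto simp: case_prod_unfold intro!: borel_measurable_times_ennreal dens[unfolded case_prod_unfold])
  also have "\<dots> = emeasure ?N A"
    by (subst emeasure_density) (auto simp: case_prod_unfold)
  finally show "emeasure ?M A = emeasure ?N A" .
qed

text \<open>Integrating out the coordinate first leaves \<open>2 \<pi> \<rho> F(\<rho>)\<close> times the integral \<open>\<kappa>(\<rho>)\<close> of \<open>k\<close> over \<open>[-\<rho>, \<rho>]\<close>. Since
\<open>\<kappa>\<close> is odd and \<open>F\<close> is even, the integral over positive \<open>\<rho>\<close> is half of an integral over the whole line, which is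
more convenient for the Fourier analysis below.\<close>

lemma integral_norm_coordinate:
  fixes F k \<kappa> :: "real \<Rightarrow> real"
  assumes F: "continuous_on UNIV F" and k: "continuous_on UNIV k" "\<And>a. \<bar>k a\<bar> \<le> 1"
    and int: "integrable lborel (\<lambda>\<rho>. \<rho>\<^sup>2 * F \<rho>)"
    and \<kappa>: "\<And>\<rho>. \<rho> \<ge> 0 \<Longrightarrow> (\<integral>a. k a * indicator {-\<rho>..\<rho>} a \<partial>lborel) = \<kappa> \<rho>"
    and even: "\<And>\<rho>. F (- \<rho>) = F \<rho>" "\<And>\<rho>. \<kappa> (- \<rho>) = - \<kappa> \<rho>"
  shows "integrable lborel (\<lambda>x :: real^3. F (norm x) * k (x $ 1))"
    and "(\<integral>x. F (norm x) * k (x $ 1) \<partial>(lborel :: (real^3) measure)) = pi * (\<integral>\<rho>. \<rho> * F \<rho> * \<kappa> \<rho> \<partial>lborel)"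
proof -
  define w where "w = (\<lambda>p :: real \<times> real. 2 * pi * fst p * indicator {-fst p..fst p} (snd p))"
  define g where "g = (\<lambda>p. F (fst p) * k (snd p))"
  have [measurable]: "F \<in> borel_measurable borel" "k \<in> borel_measurable borel"
    using F k by (auto intro: borel_measurable_continuous_onI)
  have w_meas [measurable]: "w \<in> borel_measurable (lborel \<Otimes>\<^sub>M lborel)"
    unfolding w_def by (rule borel_measurable_cone_indicator)
  have g_meas [measurable]: "g \<in> borel_measurable (lborel \<Otimes>\<^sub>M lborel)" "g \<in> borel_measurable (borel \<Otimes>\<^sub>M borel)"
    unfolding g_def by measurable
  have w_nonneg: "0 \<le> w p" for p
    by (auto simp: w_def indicator_def)
  have coord [measurable]: "(\<lambda>x :: real^3. x $ 1) \<in> borel_measurable borel"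
    by (intro borel_measurable_continuous_onI continuous_intros)
  have D: "distr (lborel :: (real^3) measure) (borel \<Otimes>\<^sub>M borel) (\<lambda>x. (norm x, x $ 1)) = density (lborel \<Otimes>\<^sub>M lborel) w"
    unfolding distr_norm_coordinate w_def case_prod_unfold ..
  have k_bound: "\<bar>k a * indicator {-\<rho>..\<rho>} a\<bar> \<le> indicator {-\<rho>..\<rho>} a" for a \<rho>
    using k(2)[of a] by (auto simp: indicator_def)
  have k_int: "integrable lborel (\<lambda>a. k a * indicator {-\<rho>..\<rho>} a)" for \<rho>
    by (rule Bochner_Integration.integrable_bound[of _ "indicator {-\<rho>..\<rho>} :: real \<Rightarrow> real"])
       (use k_bound in \<open>auto intro!: integrable_real_indicator simp: emeasure_lborel_Icc_eq\<close>)
  have wg_int: "integrable (lborel \<Otimes>\<^sub>M lborel) (\<lambda>p. w p * g p)"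
  proof (rule lborel_pair.Fubini_integrable)
    have "integrable lborel (\<lambda>\<rho>. 4 * pi * \<bar>\<rho>\<^sup>2 * F \<rho>\<bar>)"
      using int by simp
    then show "integrable lborel (\<lambda>\<rho>. \<integral>a. norm (w (\<rho>, a) * g (\<rho>, a)) \<partial>lborel)"
    proof (rule Bochner_Integration.integrable_bound)
      have "norm (\<integral>a. norm (w (\<rho>, a) * g (\<rho>, a)) \<partial>lborel) \<le> norm (4 * pi * \<bar>\<rho>\<^sup>2 * F \<rho>\<bar>)" for \<rho>
      proof (cases "\<rho> \<ge> 0")
        case True
        have "(\<integral>a. norm (w (\<rho>, a) * g (\<rho>, a)) \<partial>lborel)
            \<le> (\<integral>a. 2 * pi * \<rho> * \<bar>F \<rho>\<bar> * indicator {-\<rho>..\<rho>} a \<partial>lborel)"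
        proof (rule integral_mono')
          show "norm (w (\<rho>, a) * g (\<rho>, a)) \<le> 2 * pi * \<rho> * \<bar>F \<rho>\<bar> * indicator {-\<rho>..\<rho>} a" for a
            using k(2)[of a] True
            by (auto simp: w_def g_def indicator_def abs_mult intro!: mult_left_mono mult_left_le)
        qed (use True in auto)
        also have "\<dots> = 4 * pi * \<bar>\<rho>\<^sup>2 * F \<rho>\<bar>"
          using True by (simp add: abs_mult power2_eq_square)
        finally show ?thesis by (simp add: integral_nonneg_AE)
      next
        case False
        then have "w (\<rho>, a) = 0" for a by (auto simp: w_def)
        then show ?thesis by simp
      qed
      then show "AE \<rho> in lborel. norm (\<integral>a. norm (w (\<rho>, a) * g (\<rho>, a)) \<partial>lborel) \<le> norm (4 * pi * \<bar>\<rho>\<^sup>2 * F \<rho>\<bar>)"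
        by simp
    qed measurable
    show "AE \<rho> in lborel. integrable lborel (\<lambda>a. w (\<rho>, a) * g (\<rho>, a))"
    proof (rule AE_I2)
      fix \<rho> :: real
      have "integrable lborel (\<lambda>a. 2 * pi * \<rho> * F \<rho> * (k a * indicator {-\<rho>..\<rho>} a))"
        using k_int by simp
      then show "integrable lborel (\<lambda>a. w (\<rho>, a) * g (\<rho>, a))"
        by (simp add: w_def g_def mult_ac)
    qed
  qed measurable
  have int_distr: "integrable (density (lborel \<Otimes>\<^sub>M lborel) w) g"
    using wg_int w_nonneg by (subst integrable_real_density) auto
  show "integrable lborel (\<lambda>x :: real^3. F (norm x) * k (x $ 1))"
    using int_distr unfolding D[symmetric] by (subst (asm) integrable_distr_eq) (auto simp: g_def)
  have inner: "(\<lambda>\<rho>. \<integral>a. w (\<rho>, a) * g (\<rho>, a) \<partial>lborel) = (\<lambda>\<rho>. indicator {0..} \<rho> *\<^sub>R (2 * pi * (\<rho> * F \<rho> * \<kappa> \<rho>)))"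
  proof (rule ext)
    fix \<rho> :: real
    show "(\<integral>a. w (\<rho>, a) * g (\<rho>, a) \<partial>lborel) = indicator {0..} \<rho> *\<^sub>R (2 * pi * (\<rho> * F \<rho> * \<kappa> \<rho>))"
    proof (cases "\<rho> \<ge> 0")
      case True
      have "(\<integral>a. w (\<rho>, a) * g (\<rho>, a) \<partial>lborel) = (\<integral>a. 2 * pi * \<rho> * F \<rho> * (k a * indicator {-\<rho>..\<rho>} a) \<partial>lborel)"
        by (intro Bochner_Integration.integral_cong) (auto simp: w_def g_def)
      then show ?thesis using True \<kappa>[OF True] by simp
    next
      case False
      then have "w (\<rho>, a) = 0" for a by (auto simp: w_def)
      then show ?thesis using False by simp
    qed
  qed
  have "(\<integral>x. F (norm x) * k (x $ 1) \<partial>(lborel :: (real^3) measure))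
      = (\<integral>p. g p \<partial>density (lborel \<Otimes>\<^sub>M lborel) w)"
    unfolding D[symmetric] by (subst integral_distr) (auto simp: g_def)
  also have "\<dots> = (\<integral>p. w p * g p \<partial>(lborel \<Otimes>\<^sub>M lborel))"
    using w_nonneg by (subst integral_real_density) auto
  also have "\<dots> = (\<integral>\<rho>. (\<integral>a. w (\<rho>, a) * g (\<rho>, a) \<partial>lborel) \<partial>lborel)"
    by (rule lborel_pair.integral_fst'[symmetric]) (rule wg_int)
  also have "\<dots> = (\<integral>\<rho>. indicator {0..} \<rho> *\<^sub>R (2 * pi * (\<rho> * F \<rho> * \<kappa> \<rho>)) \<partial>lborel)"
    unfolding inner ..
  also have "\<dots> = pi * (\<integral>\<rho>. \<rho> * F \<rho> * \<kappa> \<rho> \<partial>lborel)"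
  proof -
    have "integrable lborel (\<lambda>\<rho>. indicator {0..} \<rho> *\<^sub>R (2 * pi * (\<rho> * F \<rho> * \<kappa> \<rho>)))"
      using lborel_pair.integrable_fst'[OF wg_int] unfolding inner .
    then have "has_bochner_integral lborel (\<lambda>\<rho>. 2 * pi * (\<rho> * F \<rho> * \<kappa> \<rho>))
        (2 *\<^sub>R (\<integral>\<rho>. indicator {0..} \<rho> *\<^sub>R (2 * pi * (\<rho> * F \<rho> * \<kappa> \<rho>)) \<partial>lborel))"
      by (intro has_bochner_integral_even_function has_bochner_integral_integrable) (simp_all add: even)
    from has_bochner_integral_integral_eq[OF this] show ?thesis
      by simp
  qed
  finally show "(\<integral>x. F (norm x) * k (x $ 1) \<partial>(lborel :: (real^3) measure)) = pi * (\<integral>\<rho>. \<rho> * F \<rho> * \<kappa> \<rho> \<partial>lborel)" .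
qed

section \<open>Sine transforms with a Gaussian weight\<close>

lemma integrable_sin_mult:
  fixes \<phi> :: "real \<Rightarrow> real"
  assumes "integrable lborel \<phi>"
  shows "integrable lborel (\<lambda>r. \<phi> r * sin (x * r))"
proof (rule Bochner_Integration.integrable_bound[OF assms])
  show "(\<lambda>r. \<phi> r * sin (x * r)) \<in> borel_measurable lborel"
    using assms by measurable
  show "AE r in lborel. norm (\<phi> r * sin (x * r)) \<le> norm (\<phi> r)"
    by (auto simp: abs_mult intro!: mult_left_le)
qed

text \<open>This instance of Fubini's theorem serves in two directions: it moves the Gaussian weight onto the profile
\<open>\<phi>\<close>, and it moves the truncated tail density onto the transform of \<open>\<phi>\<close>.\<close>

lemma sine_transform_swap:
  fixes \<phi> m :: "real \<Rightarrow> real"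
  assumes \<phi>: "integrable lborel \<phi>" and m: "integrable lborel m"
  shows "(\<integral>x. (\<integral>r. \<phi> r * sin (x * r) \<partial>lborel) * m x \<partial>lborel)
       = (\<integral>r. \<phi> r * (\<integral>x. sin (x * r) * m x \<partial>lborel) \<partial>lborel)"
proof -
  have [measurable]: "\<phi> \<in> borel_measurable borel" "m \<in> borel_measurable borel"
    using \<phi> m by auto
  have int: "integrable (lborel \<Otimes>\<^sub>M lborel) (\<lambda>(x, r). \<phi> r * sin (x * r) * m x)"
  proof (rule lborel_pair.Fubini_integrable)
    have bound: "norm (\<integral>r. norm (\<phi> r * sin (x * r) * m x) \<partial>lborel) \<le> norm ((\<integral>r. \<bar>\<phi> r\<bar> \<partial>lborel) * m x)" for x
    proof -
      have "(\<integral>r. norm (\<phi> r * sin (x * r) * m x) \<partial>lborel) \<le> (\<integral>r. \<bar>\<phi> r\<bar> * \<bar>m x\<bar> \<partial>lborel)"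
        using \<phi> by (intro integral_mono') (auto simp: abs_mult intro!: mult_right_mono mult_left_le)
      then show ?thesis
        by (simp add: integral_nonneg_AE abs_mult)
    qed
    have "integrable lborel (\<lambda>x. (\<integral>r. \<bar>\<phi> r\<bar> \<partial>lborel) * m x)"
      using m by simp
    then show "integrable lborel (\<lambda>x. \<integral>r. norm (case (x, r) of (x, r) \<Rightarrow> \<phi> r * sin (x * r) * m x) \<partial>lborel)"
      by (rule Bochner_Integration.integrable_bound) (use bound in auto)
    show "AE x in lborel. integrable lborel (\<lambda>r. case (x, r) of (x, r) \<Rightarrow> \<phi> r * sin (x * r) * m x)"
      using integrable_sin_mult[OF \<phi>] by simp
  qed measurable
  have "(\<integral>x. (\<integral>r. \<phi> r * sin (x * r) \<partial>lborel) * m x \<partial>lborel)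
      = (\<integral>x. (\<integral>r. \<phi> r * sin (x * r) * m x \<partial>lborel) \<partial>lborel)"
    by simp
  also have "\<dots> = (\<integral>r. (\<integral>x. \<phi> r * sin (x * r) * m x \<partial>lborel) \<partial>lborel)"
    by (rule lborel_pair.Fubini_integral[symmetric]) (rule int)
  also have "\<dots> = (\<integral>r. \<phi> r * (\<integral>x. sin (x * r) * m x \<partial>lborel) \<partial>lborel)"
    by (simp add: mult.assoc)
  finally show ?thesis .
qed

lemma integrable_std_normal_mult_bounded:
  fixes g :: "real \<Rightarrow> real"
  assumes "g \<in> borel_measurable borel" "\<And>u. \<bar>g u\<bar> \<le> B"
  shows "integrable lborel (\<lambda>u. std_normal_density u * \<bar>u\<bar> ^ k * g u)"
proof (rule Bochner_Integration.integrable_bound)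
  show "integrable lborel (\<lambda>u. B * (std_normal_density u * \<bar>u\<bar> ^ k))"
    using integrable_std_normal_moment_abs by simp
  have "B \<ge> 0" using assms(2)[of 0] by linarith
  then show "AE u in lborel. norm (std_normal_density u * \<bar>u\<bar> ^ k * g u)
      \<le> norm (B * (std_normal_density u * \<bar>u\<bar> ^ k))"
    using assms(2) by (auto simp: abs_mult mult.commute[of B] intro!: mult_left_mono)
qed (use assms in measurable)

lemma integral_std_normal_cos:
  "(\<integral>u. std_normal_density u * cos (t * u) \<partial>lborel) = exp (- (t\<^sup>2) / 2)"
proof -
  have "complex_of_real (exp (- (t\<^sup>2) / 2)) = (\<integral>u. iexp (t * u) \<partial>std_normal_distribution)"
    using char_std_normal_distribution by (simp add: char_def fun_eq_iff)
  also have "\<dots> = (\<integral>u. std_normal_density u *\<^sub>R iexp (t * u) \<partial>lborel)"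
    by (subst integral_density) (auto simp: normal_density_nonneg)
  finally have "exp (- (t\<^sup>2) / 2) = Re (\<integral>u. std_normal_density u *\<^sub>R iexp (t * u) \<partial>lborel)"
    by (metis Re_complex_of_real)
  also have "\<dots> = (\<integral>u. Re (std_normal_density u *\<^sub>R iexp (t * u)) \<partial>lborel)"
  proof (rule integral_Re[symmetric])
    show "integrable lborel (\<lambda>u. std_normal_density u *\<^sub>R iexp (t * u))"
      by (rule Bochner_Integration.integrable_bound[of _ std_normal_density]) auto
  qed
  finally show ?thesis by (simp add: Re_exp)
qed

lemma DERIV_std_normal_density:
  "(std_normal_density has_real_derivative - (u * std_normal_density u)) (at u)"
  unfolding std_normal_density_def
  by (auto intro!: derivative_eq_intros simp: field_simps)

text \<open>The difference of the two sides is the integral of the derivative of \<open>- N(u) sin (t u)\<close>, where \<open>N\<close> is the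
standard normal density, and this function vanishes at both ends of the line.\<close>

lemma integral_std_normal_mult_sin:
  "(\<integral>u. std_normal_density u * u * sin (t * u) \<partial>lborel) = t * exp (- (t\<^sup>2) / 2)"
proof -
  define f where "f u = std_normal_density u * u * sin (t * u) - t * (std_normal_density u * cos (t * u))" for u
  have i1: "integrable lborel (\<lambda>u. std_normal_density u * u * sin (t * u))"
    by (rule Bochner_Integration.integrable_bound[OF integrable_std_normal_moment_abs[of 1]])
       (auto simp: abs_mult intro!: mult_left_le)
  have i2: "integrable lborel (\<lambda>u. std_normal_density u * cos (t * u))"
    using integrable_std_normal_mult_bounded[of "\<lambda>u. cos (t * u)" 1 0] by simp
  have lim: "((\<lambda>u. - (std_normal_density u * sin (t * u))) \<longlongrightarrow> 0) F" if "(std_normal_density \<longlongrightarrow> 0) F" for F :: "real filter"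
  proof (rule tendsto_0_le[OF that, where K = 1])
    show "\<forall>\<^sub>F u in F. norm (- (std_normal_density u * sin (t * u))) \<le> norm (std_normal_density u) * 1"
      by (auto simp: abs_mult intro!: always_eventually mult_left_le)
  qed
  have N0: "(std_normal_density \<longlongrightarrow> 0) at_top" "(std_normal_density \<longlongrightarrow> 0) at_bot"
    unfolding std_normal_density_def by real_asymp+
  have "(LBINT u=-\<infinity>..\<infinity>. f u) = 0 - 0"
  proof (rule interval_integral_FTC_integrable)
    show "((\<lambda>u. - (std_normal_density u * sin (t * u))) has_vector_derivative f u) (at u)" for u
      unfolding has_real_derivative_iff_has_vector_derivative[symmetric] f_def
      by (auto intro!: derivative_eq_intros DERIV_std_normal_density simp: field_simps)
    show "isCont f u" for u
      unfolding f_def std_normal_density_def by (intro continuous_intros) auto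
    show "set_integrable lborel (einterval (-\<infinity>) \<infinity>) f"
      using i1 i2 by (simp add: set_integrable_def f_def)
    show "(((\<lambda>u. - (std_normal_density u * sin (t * u))) \<circ> real_of_ereal) \<longlongrightarrow> 0) (at_right (-\<infinity>))"
      unfolding ereal_tendsto_simps1 by (rule lim[OF N0(2)])
    show "(((\<lambda>u. - (std_normal_density u * sin (t * u))) \<circ> real_of_ereal) \<longlongrightarrow> 0) (at_left \<infinity>)"
      unfolding ereal_tendsto_simps1 by (rule lim[OF N0(1)])
  qed auto
  then have "(\<integral>u. f u \<partial>lborel) = 0"
    by (simp add: interval_lebesgue_integral_def set_lebesgue_integral_def)
  then show ?thesis
    using i1 i2 by (simp add: f_def integral_std_normal_cos)
qed

lemma gaussian_eq_std_normal_density: "exp (- (u\<^sup>2) / 2) = sqrt (2 * pi) * std_normal_density u"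
  by (simp add: std_normal_density_def)

lemma gaussian_cos_integral:
  assumes "\<epsilon> > 0"
  shows "integrable lborel (\<lambda>x. exp (- ((\<epsilon> * x)\<^sup>2) / 2) * cos (t * x))"
    and "(\<integral>x. exp (- ((\<epsilon> * x)\<^sup>2) / 2) * cos (t * x) \<partial>lborel)
       = 2 * pi / \<epsilon> * std_normal_density (t / \<epsilon>)"
proof -
  have *: "exp (- ((\<epsilon> * (0 + 1 / \<epsilon> * u))\<^sup>2) / 2) * cos (t * (0 + 1 / \<epsilon> * u))
      = sqrt (2 * pi) * (std_normal_density u * cos (t / \<epsilon> * u))" for u
    using assms gaussian_eq_std_normal_density[of u] by simp
  have "integrable lborel (\<lambda>u. std_normal_density u * cos (t / \<epsilon> * u))"
    using integrable_std_normal_mult_bounded[of "\<lambda>u. cos (t / \<epsilon> * u)" 1 0] by simp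
  then have "integrable lborel (\<lambda>u. exp (- ((\<epsilon> * (0 + 1 / \<epsilon> * u))\<^sup>2) / 2) * cos (t * (0 + 1 / \<epsilon> * u)))"
    unfolding * by simp
  then show "integrable lborel (\<lambda>x. exp (- ((\<epsilon> * x)\<^sup>2) / 2) * cos (t * x))"
    using assms by (subst (asm) lborel_integrable_real_affine_iff) auto
  have "(\<integral>x. exp (- ((\<epsilon> * x)\<^sup>2) / 2) * cos (t * x) \<partial>lborel)
      = \<bar>1 / \<epsilon>\<bar> *\<^sub>R (\<integral>u. exp (- ((\<epsilon> * (0 + 1 / \<epsilon> * u))\<^sup>2) / 2) * cos (t * (0 + 1 / \<epsilon> * u)) \<partial>lborel)"
    using assms by (intro lborel_integral_real_affine) simp
  also have "\<dots> = 1 / \<epsilon> * (sqrt (2 * pi) * exp (- ((t / \<epsilon>)\<^sup>2) / 2))"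
    unfolding * using assms integral_std_normal_cos[of "t / \<epsilon>"] by simp
  also have "\<dots> = 2 * pi / \<epsilon> * std_normal_density (t / \<epsilon>)"
    unfolding gaussian_eq_std_normal_density by simp
  finally show "(\<integral>x. exp (- ((\<epsilon> * x)\<^sup>2) / 2) * cos (t * x) \<partial>lborel)
       = 2 * pi / \<epsilon> * std_normal_density (t / \<epsilon>)" .
qed

lemma gaussian_sin_moment_integral:
  assumes "\<epsilon> > 0"
  shows "integrable lborel (\<lambda>x. x * exp (- ((\<epsilon> * x)\<^sup>2) / 2))"
    and "(\<integral>x. sin (x * t) * (x * exp (- ((\<epsilon> * x)\<^sup>2) / 2)) \<partial>lborel)
       = 2 * pi / \<epsilon> ^ 3 * t * std_normal_density (t / \<epsilon>)"
proof -
  have *: "sin ((0 + 1 / \<epsilon> * u) * t) * ((0 + 1 / \<epsilon> * u) * exp (- ((\<epsilon> * (0 + 1 / \<epsilon> * u))\<^sup>2) / 2))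
      = sqrt (2 * pi) / \<epsilon> * (std_normal_density u * u * sin (t / \<epsilon> * u))" for u
    using assms gaussian_eq_std_normal_density[of u] by (simp add: mult.commute)
  have **: "(0 + 1 / \<epsilon> * u) * exp (- ((\<epsilon> * (0 + 1 / \<epsilon> * u))\<^sup>2) / 2)
      = sqrt (2 * pi) / \<epsilon> * (std_normal_density u * u)" for u
    using assms gaussian_eq_std_normal_density[of u] by simp
  have "integrable lborel (\<lambda>u. std_normal_density u * u)"
    using integrable_normal_moment_nz_1[of 1 0] by simp
  then have "integrable lborel (\<lambda>u. (0 + 1 / \<epsilon> * u) * exp (- ((\<epsilon> * (0 + 1 / \<epsilon> * u))\<^sup>2) / 2))"
    unfolding ** by simp
  then show "integrable lborel (\<lambda>x. x * exp (- ((\<epsilon> * x)\<^sup>2) / 2))"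
    using assms by (subst (asm) lborel_integrable_real_affine_iff) auto
  have "(\<integral>x. sin (x * t) * (x * exp (- ((\<epsilon> * x)\<^sup>2) / 2)) \<partial>lborel)
      = \<bar>1 / \<epsilon>\<bar> *\<^sub>R (\<integral>u. sin ((0 + 1 / \<epsilon> * u) * t) * ((0 + 1 / \<epsilon> * u) * exp (- ((\<epsilon> * (0 + 1 / \<epsilon> * u))\<^sup>2) / 2)) \<partial>lborel)"
    using assms by (intro lborel_integral_real_affine) simp
  also have "\<dots> = 1 / \<epsilon> * (sqrt (2 * pi) / \<epsilon> * (t / \<epsilon> * exp (- ((t / \<epsilon>)\<^sup>2) / 2)))"
    unfolding * using assms integral_std_normal_mult_sin[of "t / \<epsilon>"] by simp
  also have "\<dots> = 2 * pi / \<epsilon> ^ 3 * t * std_normal_density (t / \<epsilon>)"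
    unfolding gaussian_eq_std_normal_density by (simp add: field_simps power3_eq_cube)
  finally show "(\<integral>x. sin (x * t) * (x * exp (- ((\<epsilon> * x)\<^sup>2) / 2)) \<partial>lborel)
       = 2 * pi / \<epsilon> ^ 3 * t * std_normal_density (t / \<epsilon>)" .
qed

text \<open>Nothing is known about the decay of the sine transform of \<open>\<phi>\<close>, so it is inverted with a Gaussian
weight. The product \<open>sin (x r) sin (\<rho> x)\<close> is half the difference of two cosines, so the weight turns into Gaussian
bumps at \<open>\<rho>\<close> and \<open>-\<rho>\<close>; as \<open>\<phi>\<close> is odd, both contribute the same smoothed value of \<open>\<phi>\<close>.\<close>

lemma sine_inversion_smoothed:
  fixes \<phi> :: "real \<Rightarrow> real"
  assumes \<phi>: "integrable lborel \<phi>" and odd: "\<And>r. \<phi> (- r) = - \<phi> r" and "\<epsilon> > 0"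
  shows "(\<integral>x. (\<integral>r. \<phi> r * sin (x * r) \<partial>lborel) * (sin (\<rho> * x) * exp (- ((\<epsilon> * x)\<^sup>2) / 2)) \<partial>lborel)
       = 2 * pi * (\<integral>u. std_normal_density u * \<phi> (\<rho> + \<epsilon> * u) \<partial>lborel)"
proof -
  let ?N = std_normal_density
  have E: "integrable lborel (\<lambda>x. exp (- ((\<epsilon> * x)\<^sup>2) / 2) * cos (t * x))" for t
    using gaussian_cos_integral[OF \<open>\<epsilon> > 0\<close>] by simp
  have m: "integrable lborel (\<lambda>x. sin (\<rho> * x) * exp (- ((\<epsilon> * x)\<^sup>2) / 2))"
    using integrable_sin_mult[of "\<lambda>x. exp (- ((\<epsilon> * x)\<^sup>2) / 2)" \<rho>] E[of 0] by (simp add: mult.commute)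
  have inner: "(\<integral>x. sin (x * r) * (sin (\<rho> * x) * exp (- ((\<epsilon> * x)\<^sup>2) / 2)) \<partial>lborel)
      = pi / \<epsilon> * (?N ((r - \<rho>) / \<epsilon>) - ?N ((r + \<rho>) / \<epsilon>))" for r
  proof -
    have "(\<integral>x. sin (x * r) * (sin (\<rho> * x) * exp (- ((\<epsilon> * x)\<^sup>2) / 2)) \<partial>lborel)
        = (\<integral>x. (exp (- ((\<epsilon> * x)\<^sup>2) / 2) * cos ((r - \<rho>) * x) - exp (- ((\<epsilon> * x)\<^sup>2) / 2) * cos ((r + \<rho>) * x)) / 2 \<partial>lborel)"
      by (intro Bochner_Integration.integral_cong) (auto simp: algebra_simps cos_add cos_diff)
    also have "\<dots> = ((\<integral>x. exp (- ((\<epsilon> * x)\<^sup>2) / 2) * cos ((r - \<rho>) * x) \<partial>lborel)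
        - (\<integral>x. exp (- ((\<epsilon> * x)\<^sup>2) / 2) * cos ((r + \<rho>) * x) \<partial>lborel)) / 2"
      by (subst integral_divide_zero, subst Bochner_Integration.integral_diff[OF E E]) (rule refl)
    also have "\<dots> = pi / \<epsilon> * (?N ((r - \<rho>) / \<epsilon>) - ?N ((r + \<rho>) / \<epsilon>))"
      unfolding gaussian_cos_integral(2)[OF \<open>\<epsilon> > 0\<close>] by (simp add: right_diff_distrib diff_divide_distrib)
    finally show ?thesis .
  qed
  have N_bound: "\<bar>?N u\<bar> \<le> 1" for u
  proof -
    have "1 \<le> sqrt (2 * pi)" using pi_gt3 by simp
    then show ?thesis by (simp add: std_normal_density_def divide_le_eq exp_le_one_iff order_trans[of _ 1])
  qed
  have int: "integrable lborel (\<lambda>r. \<phi> r * ?N ((r + c) / \<epsilon>))" for c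
  proof (rule Bochner_Integration.integrable_bound[OF \<phi>])
    show "(\<lambda>r. \<phi> r * ?N ((r + c) / \<epsilon>)) \<in> borel_measurable lborel"
      using \<phi> by measurable
    show "AE r in lborel. norm (\<phi> r * ?N ((r + c) / \<epsilon>)) \<le> norm (\<phi> r)"
      using N_bound by (auto simp: abs_mult intro!: mult_left_le)
  qed
  have even: "?N (- u) = ?N u" for u by (simp add: std_normal_density_def)
  have reflect: "(\<integral>r. \<phi> r * ?N ((r + \<rho>) / \<epsilon>) \<partial>lborel) = - (\<integral>r. \<phi> r * ?N ((r - \<rho>) / \<epsilon>) \<partial>lborel)"
  proof -
    have "(\<integral>r. \<phi> r * ?N ((r + \<rho>) / \<epsilon>) \<partial>lborel) = (\<integral>r. \<phi> (0 + -1 * r) * ?N (((0 + -1 * r) + \<rho>) / \<epsilon>) \<partial>lborel)"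
      by (subst lborel_integral_real_affine[of "-1" _ 0]) auto
    also have "\<dots> = (\<integral>r. - (\<phi> r * ?N ((r - \<rho>) / \<epsilon>)) \<partial>lborel)"
    proof (intro Bochner_Integration.integral_cong refl)
      fix r
      have "((0 + -1 * r) + \<rho>) / \<epsilon> = - ((r - \<rho>) / \<epsilon>)"
        by (simp add: diff_divide_distrib add_divide_distrib)
      then show "\<phi> (0 + -1 * r) * ?N (((0 + -1 * r) + \<rho>) / \<epsilon>) = - (\<phi> r * ?N ((r - \<rho>) / \<epsilon>))"
        using even[of "(r - \<rho>) / \<epsilon>"] by (simp add: odd)
    qed
    finally show ?thesis by simp
  qed
  have "(\<integral>x. (\<integral>r. \<phi> r * sin (x * r) \<partial>lborel) * (sin (\<rho> * x) * exp (- ((\<epsilon> * x)\<^sup>2) / 2)) \<partial>lborel)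
      = (\<integral>r. \<phi> r * (pi / \<epsilon> * (?N ((r - \<rho>) / \<epsilon>) - ?N ((r + \<rho>) / \<epsilon>))) \<partial>lborel)"
    unfolding sine_transform_swap[OF \<phi> m] inner ..
  also have "\<dots> = (\<integral>r. pi / \<epsilon> * (\<phi> r * ?N ((r - \<rho>) / \<epsilon>) - \<phi> r * ?N ((r + \<rho>) / \<epsilon>)) \<partial>lborel)"
    by (intro Bochner_Integration.integral_cong) (auto simp: algebra_simps)
  also have "\<dots> = 2 * pi / \<epsilon> * (\<integral>r. \<phi> r * ?N ((r - \<rho>) / \<epsilon>) \<partial>lborel)"
    using int[of \<rho>] int[of "- \<rho>"] by (simp add: reflect)
  also have "(\<integral>r. \<phi> r * ?N ((r - \<rho>) / \<epsilon>) \<partial>lborel) = \<epsilon> * (\<integral>u. ?N u * \<phi> (\<rho> + \<epsilon> * u) \<partial>lborel)"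
    using \<open>\<epsilon> > 0\<close> by (subst lborel_integral_real_affine[of \<epsilon> _ \<rho>]) (auto simp: mult.commute)
  finally show ?thesis using \<open>\<epsilon> > 0\<close> by simp
qed

text \<open>With the factor \<open>x\<close> in place of \<open>sin (\<rho> x)\<close> one recovers the derivative of \<open>r F(r)\<close> at the origin, that is
\<open>F 0\<close>. No derivative of \<open>F\<close> is involved: the extra factor \<open>x\<close> becomes the derivative of the Gaussian, and
together with \<open>r F(r)\<close> it produces the weight \<open>u\<^sup>2 N(u)\<close>, whose total mass is one.\<close>

lemma sine_inversion_derivative_smoothed:
  fixes F :: "real \<Rightarrow> real"
  assumes \<phi>: "integrable lborel (\<lambda>r. r * F r)" and "\<epsilon> > 0"
  shows "(\<integral>x. (\<integral>r. r * F r * sin (x * r) \<partial>lborel) * (x * exp (- ((\<epsilon> * x)\<^sup>2) / 2)) \<partial>lborel)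
       = 2 * pi * (\<integral>u. std_normal_density u * u\<^sup>2 * F (\<epsilon> * u) \<partial>lborel)"
proof -
  let ?N = std_normal_density
  have "(\<integral>x. (\<integral>r. r * F r * sin (x * r) \<partial>lborel) * (x * exp (- ((\<epsilon> * x)\<^sup>2) / 2)) \<partial>lborel)
      = (\<integral>r. r * F r * (2 * pi / \<epsilon> ^ 3 * r * ?N (r / \<epsilon>)) \<partial>lborel)"
    unfolding sine_transform_swap[OF \<phi> gaussian_sin_moment_integral(1)[OF \<open>\<epsilon> > 0\<close>]]
      gaussian_sin_moment_integral(2)[OF \<open>\<epsilon> > 0\<close>] ..
  also have "\<dots> = \<epsilon> * (\<integral>u. (\<epsilon> * u) * F (\<epsilon> * u) * (2 * pi / \<epsilon> ^ 3 * (\<epsilon> * u) * ?N ((\<epsilon> * u) / \<epsilon>)) \<partial>lborel)"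
    using \<open>\<epsilon> > 0\<close> by (subst lborel_integral_real_affine[of \<epsilon> _ 0]) auto
  also have "\<dots> = \<epsilon> * (\<integral>u. 2 * pi / \<epsilon> * (?N u * u\<^sup>2 * F (\<epsilon> * u)) \<partial>lborel)"
    using \<open>\<epsilon> > 0\<close>
    by (intro arg_cong[where f = "\<lambda>z. \<epsilon> * z"] Bochner_Integration.integral_cong)
       (auto simp: field_simps power2_eq_square power3_eq_cube)
  finally show ?thesis using \<open>\<epsilon> > 0\<close> by simp
qed

section \<open>The dual bound for radial functions\<close>

lemma weighted_dilation_limit:
  fixes g w :: "real \<Rightarrow> real"
  assumes g: "continuous_on UNIV g" "\<And>u. \<bar>g u\<bar> \<le> B" and w: "integrable lborel w"
  shows "(\<lambda>n. \<integral>u. w u * g (\<rho> + inverse (real (Suc n)) * u) \<partial>lborel) \<longlonglongrightarrow> (\<integral>u. w u \<partial>lborel) * g \<rho>"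
proof -
  have [measurable]: "g \<in> borel_measurable borel" "w \<in> borel_measurable borel"
    using g w by (auto intro: borel_measurable_continuous_onI)
  have "(\<lambda>n. \<integral>u. w u * g (\<rho> + inverse (real (Suc n)) * u) \<partial>lborel) \<longlonglongrightarrow> (\<integral>u. w u * g \<rho> \<partial>lborel)"
  proof (rule integral_dominated_convergence[where w = "\<lambda>u. B * \<bar>w u\<bar>"])
    show "AE u in lborel. (\<lambda>n. w u * g (\<rho> + inverse (real (Suc n)) * u)) \<longlonglongrightarrow> w u * g \<rho>"
    proof (rule AE_I2, rule tendsto_mult_left)
      fix u :: real
      have "(\<lambda>n. \<rho> + inverse (real (Suc n)) * u) \<longlonglongrightarrow> \<rho> + 0 * u"
        by (intro tendsto_intros LIMSEQ_inverse_real_of_nat)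
      moreover have "isCont g (\<rho> + 0 * u)"
        using g by (simp add: continuous_on_eq_continuous_at)
      ultimately show "(\<lambda>n. g (\<rho> + inverse (real (Suc n)) * u)) \<longlonglongrightarrow> g \<rho>"
        using isCont_tendsto_compose by fastforce
    qed
    show "AE u in lborel. norm (w u * g (\<rho> + inverse (real (Suc n)) * u)) \<le> B * \<bar>w u\<bar>" for n
      using g(2) by (auto simp: abs_mult mult.commute[of B] intro!: mult_left_mono)
  qed (use w in auto)
  then show ?thesis by simp
qed

text \<open>A dual certificate for radial functions on three-space, written in terms of the profile \<open>F\<close>. Put \<open>\<phi>(r) = r F(r)\<close>
and let \<open>T\<close> be its sine transform. Up to positive factors, \<open>T(x)\<close> is \<open>x\<close> times the Fourier
transform at radius \<open>x / 2\<pi>\<close>, and \<open>\<integral> r\<^sup>2 F(r)\<close> is the Fourier transform at the origin. Consider the measure made of a unit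
mass at the origin, spherical shells of radii \<open>a j\<close>, and the density proportional to \<open>C q(r) / r\<close> for \<open>r \<ge> L\<close>.
The last part, extended to all \<open>r\<close>, transforms into point masses: one at the origin and shells of radii
\<open>\<xi> i\<close>. What is left of the transform is \<open>H(x) / x\<close>, where \<open>H\<close> is the function in the last hypothesis. Integrating \<open>f\<close>
against this measure gives at most \<open>F 0\<close>, because \<open>F \<le> 0\<close> beyond radius 1; integrating the Fourier transform of
\<open>f\<close> against the transformed measure gives at least the contribution of the origin, because everything else is
nonnegative.

Allowing the oscillating terms in \<open>q\<close> is what makes the certificate short. With \<open>q(r) = r\<close> the error committed at
radius \<open>L\<close> decreases only like \<open>1 / L\<^sup>2\<close>, while the first two shells \<open>\<xi> i\<close> bring \<open>L\<close> down to about \<open>3/2\<close>.\<close>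

theorem radial_dual_certificate:
  fixes F :: "real \<Rightarrow> real" and I :: "'i set" and J :: "'j set"
  assumes F_cont: "continuous_on UNIV F" and F_even: "\<And>r. F (- r) = F r"
    and F_bound: "\<And>r. \<bar>F r\<bar> \<le> K" and \<phi>_bound: "\<And>r. \<bar>r * F r\<bar> \<le> K"
    and int1: "integrable lborel (\<lambda>r. r * F r)" and int2: "integrable lborel (\<lambda>r. r\<^sup>2 * F r)"
    and T_nonneg: "\<And>x. x > 0 \<Longrightarrow> 0 \<le> (\<integral>r. r * F r * sin (x * r) \<partial>lborel)"
    and F_nonpos: "\<And>r. r \<ge> 1 \<Longrightarrow> F r \<le> 0"
    and fin: "finite I" "finite J"
    and e: "\<And>i. i \<in> I \<Longrightarrow> e i \<ge> 0" "\<And>i. i \<in> I \<Longrightarrow> \<xi> i > 0"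
    and W: "\<And>j. j \<in> J \<Longrightarrow> W j \<ge> 0" "\<And>j. j \<in> J \<Longrightarrow> a j \<ge> 1"
    and L: "L \<ge> 1" and C: "C \<ge> 0"
    and q_def: "\<And>r. q r = r + (\<Sum>i\<in>I. e i * sin (\<xi> i * r))"
    and q_nonneg: "\<And>r. r \<ge> L \<Longrightarrow> q r \<ge> 0"
    and H_nonneg: "\<And>x. x > 0 \<Longrightarrow>
       0 \<le> x + (\<Sum>j\<in>J. W j * sin (a j * x)) - C * (\<integral>r. q r * indicator {0..L} r * sin (x * r) \<partial>lborel)"
  shows "C * (\<integral>r. r\<^sup>2 * F r \<partial>lborel) \<le> 2 * F 0"
proof -
  define \<phi> where "\<phi> = (\<lambda>r. r * F r)"
  define T where "T = (\<lambda>x. \<integral>r. \<phi> r * sin (x * r) \<partial>lborel)"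
  define p where "p = (\<lambda>r. q r * indicator {0..L} r)"
  define h where "h = (\<lambda>x. \<integral>r. p r * sin (x * r) \<partial>lborel)"
  define H where "H = (\<lambda>x. x + (\<Sum>j\<in>J. W j * sin (a j * x)) - C * h x)"
  define \<epsilon> where "\<epsilon> = (\<lambda>n. inverse (real (Suc n)))"
  define E where "E = (\<lambda>n x. exp (- ((\<epsilon> n * x)\<^sup>2) / 2))"
  define A where "A = (\<lambda>n \<rho>. 2 * pi * (\<integral>u. std_normal_density u * \<phi> (\<rho> + \<epsilon> n * u) \<partial>lborel))"
  define D where "D = (\<lambda>n. 2 * pi * (\<integral>u. std_normal_density u * u\<^sup>2 * F (0 + \<epsilon> n * u) \<partial>lborel))"
  have \<epsilon>_pos: "\<epsilon> n > 0" for n by (simp add: \<epsilon>_def)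
  have K: "K \<ge> 0" using F_bound[of 0] by linarith
  have \<phi>_cont: "continuous_on UNIV \<phi>" unfolding \<phi>_def by (intro continuous_intros F_cont)
  have \<phi>_int: "integrable lborel \<phi>" using int1 by (simp add: \<phi>_def)
  have \<phi>_odd: "\<phi> (- r) = - \<phi> r" for r by (simp add: \<phi>_def F_even)
  have \<phi>_bd: "\<bar>\<phi> r\<bar> \<le> K" for r using \<phi>_bound by (simp add: \<phi>_def)
  have q_cont: "continuous_on S q" for S
    unfolding q_def by (intro continuous_intros)
  have p_int: "integrable lborel p"
    using borel_integrable_atLeastAtMost'[OF q_cont, of 0 L]
    by (simp add: p_def set_integrable_def mult.commute)
  have [measurable]: "\<phi> \<in> borel_measurable borel" "p \<in> borel_measurable borel" "F \<in> borel_measurable borel"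
      "q \<in> borel_measurable borel"
    using \<phi>_int p_int F_cont q_cont by (auto intro: borel_measurable_continuous_onI)
  have T_meas [measurable]: "T \<in> borel_measurable borel" and h_meas [measurable]: "h \<in> borel_measurable borel"
    unfolding T_def h_def by measurable
  have transform_bound: "\<bar>\<integral>r. f r * sin (x * r) \<partial>lborel\<bar> \<le> (\<integral>r. \<bar>f r\<bar> \<partial>lborel)"
    if "integrable lborel f" for f :: "real \<Rightarrow> real" and x
  proof -
    have "norm (\<integral>r. f r * sin (x * r) \<partial>lborel) \<le> (\<integral>r. norm (f r * sin (x * r)) \<partial>lborel)"
      by (rule integral_norm_bound)
    also have "\<dots> \<le> (\<integral>r. \<bar>f r\<bar> \<partial>lborel)"
      using that by (intro integral_mono') (auto simp: abs_mult intro!: mult_left_le)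
    finally show ?thesis by simp
  qed
  have T_bd: "\<bar>T x\<bar> \<le> (\<integral>r. \<bar>\<phi> r\<bar> \<partial>lborel)" and h_bd: "\<bar>h x\<bar> \<le> (\<integral>r. \<bar>p r\<bar> \<partial>lborel)" for x
    unfolding T_def h_def using transform_bound[OF \<phi>_int] transform_bound[OF p_int] by auto
  have bounded_mult: "integrable lborel (\<lambda>x. f x * m x)"
    if f: "f \<in> borel_measurable borel" and bd: "\<And>x. \<bar>f x\<bar> \<le> B" and m: "integrable lborel m"
    for f m :: "real \<Rightarrow> real" and B
  proof (rule Bochner_Integration.integrable_bound)
    show "integrable lborel (\<lambda>x. B * m x)" using m by simp
    have "\<bar>f x\<bar> * \<bar>m x\<bar> \<le> \<bar>B\<bar> * \<bar>m x\<bar>" for x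
      by (rule mult_right_mono) (use bd[of x] in auto)
    then show "AE x in lborel. norm (f x * m x) \<le> norm (B * m x)"
      by (simp add: abs_mult)
    show "(\<lambda>x. f x * m x) \<in> borel_measurable lborel"
      using f borel_measurable_integrable[OF m] by simp
  qed
  have E_int: "integrable lborel (E n)" for n
    using gaussian_cos_integral(1)[OF \<epsilon>_pos, of n 0] by (simp add: E_def[abs_def])
  have xE_int: "integrable lborel (\<lambda>x. x * E n x)" for n
    using gaussian_sin_moment_integral(1)[OF \<epsilon>_pos, of n] by (simp add: E_def)
  have TE_int: "integrable lborel (\<lambda>x. T x * E n x)" for n
    by (rule bounded_mult[OF T_meas T_bd E_int])
  have TsinE_int: "integrable lborel (\<lambda>x. T x * (sin (\<rho> * x) * E n x))" for n \<rho>
    using bounded_mult[of "\<lambda>x. sin (\<rho> * x)" 1, OF _ _ TE_int[of n]] by (simp add: mult_ac)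
  have TxE_int: "integrable lborel (\<lambda>x. T x * (x * E n x))" for n
    by (rule bounded_mult[OF T_meas T_bd xE_int])
  have ThE_int: "integrable lborel (\<lambda>x. h x * (T x * E n x))" for n
    by (rule bounded_mult[OF h_meas h_bd TE_int])
  have A_eq: "(\<integral>x. T x * (sin (\<rho> * x) * E n x) \<partial>lborel) = A n \<rho>" for n \<rho>
    unfolding T_def E_def A_def by (rule sine_inversion_smoothed[OF \<phi>_int \<phi>_odd \<epsilon>_pos])
  have D_eq: "(\<integral>x. T x * (x * E n x) \<partial>lborel) = D n" for n
    unfolding T_def E_def D_def \<phi>_def using sine_inversion_derivative_smoothed[OF int1 \<epsilon>_pos, of n] by simp
  have h_eq: "(\<integral>x. h x * (T x * E n x) \<partial>lborel) = (\<integral>r. p r * A n r \<partial>lborel)" for n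
    unfolding h_def sine_transform_swap[OF p_int TE_int] A_eq[symmetric] by (simp add: mult_ac)
  \<comment> \<open>\<open>T\<close> and \<open>H\<close> are odd, so their product is nonnegative on the whole line.\<close>
  have nonneg: "0 \<le> D n + (\<Sum>j\<in>J. W j * A n (a j)) - C * (\<integral>r. p r * A n r \<partial>lborel)" for n
  proof -
    have TH: "0 \<le> T x * H x" for x
    proof -
      have pos: "0 \<le> T x * H x" if "x > 0" for x
        using T_nonneg[OF that] H_nonneg[OF that] by (simp add: T_def H_def h_def p_def \<phi>_def)
      have "T (- x) = - T x" "H (- x) = - H x" for x
        by (simp_all add: T_def H_def h_def sum_negf)
      then have "T x * H x = T (- x) * H (- x)" by simp
      moreover have "T 0 = 0" by (simp add: T_def)
      ultimately show ?thesis
        using pos[of x] pos[of "- x"] by (cases x "0 :: real" rule: linorder_cases) auto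
    qed
    have "0 \<le> (\<integral>x. T x * H x * E n x \<partial>lborel)"
      using TH by (intro integral_nonneg_AE) (auto simp: E_def)
    also have "(\<lambda>x. T x * H x * E n x) = (\<lambda>x. T x * (x * E n x) + (\<Sum>j\<in>J. W j * (T x * (sin (a j * x) * E n x)))
        - C * (h x * (T x * E n x)))"
      by (auto simp: H_def fun_eq_iff algebra_simps sum_distrib_left sum_distrib_right)
    also have "(\<integral>x. T x * (x * E n x) + (\<Sum>j\<in>J. W j * (T x * (sin (a j * x) * E n x)))
        - C * (h x * (T x * E n x)) \<partial>lborel) = D n + (\<Sum>j\<in>J. W j * A n (a j)) - C * (\<integral>r. p r * A n r \<partial>lborel)"
      using TxE_int TsinE_int ThE_int
      by (simp add: Bochner_Integration.integral_diff Bochner_Integration.integral_add Bochner_Integration.integral_sum A_eq D_eq h_eq)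
    finally show ?thesis .
  qed
  have A_lim: "(\<lambda>n. A n \<rho>) \<longlonglongrightarrow> 2 * pi * \<phi> \<rho>" for \<rho>
    using tendsto_mult_left[OF weighted_dilation_limit[OF \<phi>_cont \<phi>_bd integrable_normal_density, of 1 0 \<rho>], of "2 * pi"]
    by (simp add: A_def \<epsilon>_def)
  have D_lim: "D \<longlonglongrightarrow> 2 * pi * F 0"
  proof -
    have "has_bochner_integral lborel (\<lambda>u. std_normal_density u * u\<^sup>2) 1"
      using std_normal_moment_even[of 1] by simp
    then have "integrable lborel (\<lambda>u. std_normal_density u * u\<^sup>2)" "(\<integral>u. std_normal_density u * u\<^sup>2 \<partial>lborel) = 1"
      by (auto simp: has_bochner_integral_iff)
    with tendsto_mult_left[OF weighted_dilation_limit[OF F_cont F_bound this(1), of 0], of "2 * pi"]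
    show ?thesis by (simp add: D_def[abs_def] \<epsilon>_def)
  qed
  have A_bd: "\<bar>A n \<rho>\<bar> \<le> 2 * pi * K" for n \<rho>
  proof -
    have "norm (\<integral>u. std_normal_density u * \<phi> (\<rho> + \<epsilon> n * u) \<partial>lborel)
        \<le> (\<integral>u. norm (std_normal_density u * \<phi> (\<rho> + \<epsilon> n * u)) \<partial>lborel)"
      by (rule integral_norm_bound)
    also have "\<dots> \<le> (\<integral>u. std_normal_density u * K \<partial>lborel)"
      using \<phi>_bd K by (intro integral_mono') (auto simp: abs_mult intro!: mult_left_mono)
    also have "\<dots> = K" by simp
    finally show ?thesis by (simp add: A_def abs_mult)
  qed
  have A_meas: "A n \<in> borel_measurable borel" for n
    unfolding A_def by measurable
  have pA_lim: "(\<lambda>n. \<integral>r. p r * A n r \<partial>lborel) \<longlonglongrightarrow> (\<integral>r. p r * (2 * pi * \<phi> r) \<partial>lborel)"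
  proof (rule integral_dominated_convergence[where w = "\<lambda>r. 2 * pi * K * \<bar>p r\<bar>"])
    show "AE r in lborel. (\<lambda>n. p r * A n r) \<longlonglongrightarrow> p r * (2 * pi * \<phi> r)"
      by (intro AE_I2 tendsto_mult_left A_lim)
    show "AE r in lborel. norm (p r * A n r) \<le> 2 * pi * K * \<bar>p r\<bar>" for n
      using A_bd by (auto simp: abs_mult mult.commute[of _ "\<bar>p _\<bar>"] intro!: mult_left_mono)
    show "(\<lambda>r. p r * A n r) \<in> borel_measurable lborel" for n
      using A_meas by measurable
  qed (use p_int in auto)
  have "(\<lambda>n. D n + (\<Sum>j\<in>J. W j * A n (a j)) - C * (\<integral>r. p r * A n r \<partial>lborel))
      \<longlonglongrightarrow> 2 * pi * F 0 + (\<Sum>j\<in>J. W j * (2 * pi * \<phi> (a j))) - C * (\<integral>r. p r * (2 * pi * \<phi> r) \<partial>lborel)"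
    by (intro tendsto_intros D_lim A_lim pA_lim)
  then have "0 \<le> 2 * pi * F 0 + (\<Sum>j\<in>J. W j * (2 * pi * \<phi> (a j))) - C * (\<integral>r. p r * (2 * pi * \<phi> r) \<partial>lborel)"
    by (rule LIMSEQ_le_const) (use nonneg in blast)
  also have "(\<integral>r. p r * (2 * pi * \<phi> r) \<partial>lborel) = 2 * pi * (\<integral>r. p r * \<phi> r \<partial>lborel)"
    by (subst integral_mult_right_zero[symmetric], rule Bochner_Integration.integral_cong) (simp_all add: mult_ac)
  also have "(\<Sum>j\<in>J. W j * (2 * pi * \<phi> (a j))) = 2 * pi * (\<Sum>j\<in>J. W j * \<phi> (a j))"
    by (simp add: sum_distrib_left mult_ac)
  also have "2 * pi * F 0 + 2 * pi * (\<Sum>j\<in>J. W j * \<phi> (a j)) - C * (2 * pi * (\<integral>r. p r * \<phi> r \<partial>lborel))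
      = 2 * pi * (F 0 + (\<Sum>j\<in>J. W j * \<phi> (a j)) - C * (\<integral>r. p r * \<phi> r \<partial>lborel))"
    by (simp add: right_diff_distrib distrib_left mult_ac)
  finally have main: "C * (\<integral>r. p r * \<phi> r \<partial>lborel) \<le> F 0 + (\<Sum>j\<in>J. W j * \<phi> (a j))"
    using pi_gt_zero by (auto simp: zero_le_mult_iff)
  have shells: "(\<Sum>j\<in>J. W j * \<phi> (a j)) \<le> 0"
  proof (rule sum_nonpos)
    fix j assume j: "j \<in> J"
    have "F (a j) \<le> 0" using F_nonpos W(2)[OF j] by blast
    then have "\<phi> (a j) \<le> 0"
      using W(2)[OF j] by (simp add: \<phi>_def mult_nonneg_nonpos)
    then show "W j * \<phi> (a j) \<le> 0"
      using W(1)[OF j] by (rule mult_nonneg_nonpos[rotated])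
  qed
  have q\<phi>: "q r * \<phi> r = r\<^sup>2 * F r + (\<Sum>i\<in>I. e i * (\<phi> r * sin (\<xi> i * r)))" for r
    by (simp add: q_def \<phi>_def algebra_simps power2_eq_square sum_distrib_left sum_distrib_right)
  have q\<phi>_int: "integrable lborel (\<lambda>r. q r * \<phi> r)"
    unfolding q\<phi> using int2 integrable_sin_mult[OF \<phi>_int] by auto
  \<comment> \<open>The shells \<open>\<xi> i\<close> in frequency only help, and beyond \<open>L\<close> the density \<open>q\<close> meets nonpositive values of \<open>F\<close>.\<close>
  have "(\<integral>r. r\<^sup>2 * F r \<partial>lborel) \<le> (\<integral>r. r\<^sup>2 * F r \<partial>lborel) + (\<Sum>i\<in>I. e i * T (\<xi> i))"
    using e T_nonneg by (simp add: T_def \<phi>_def sum_nonneg)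
  also have "\<dots> = (\<integral>r. q r * \<phi> r \<partial>lborel)"
    unfolding q\<phi> T_def using int2 integrable_sin_mult[OF \<phi>_int] by simp
  also have "\<dots> = 2 * (\<integral>r. indicator {0..} r *\<^sub>R (q r * \<phi> r) \<partial>lborel)"
  proof -
    have "integrable lborel (\<lambda>r. indicator {0..} r *\<^sub>R (q r * \<phi> r))"
      by (intro integrable_mult_indicator q\<phi>_int) simp
    then have "has_bochner_integral lborel (\<lambda>r. q r * \<phi> r) (2 *\<^sub>R (\<integral>r. indicator {0..} r *\<^sub>R (q r * \<phi> r) \<partial>lborel))"
      by (intro has_bochner_integral_even_function has_bochner_integral_integrable)
         (simp_all add: q_def \<phi>_odd sum_negf algebra_simps)
    from has_bochner_integral_integral_eq[OF this] show ?thesis by simp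
  qed
  also have "(\<integral>r. indicator {0..} r *\<^sub>R (q r * \<phi> r) \<partial>lborel) \<le> (\<integral>r. p r * \<phi> r \<partial>lborel)"
  proof (rule integral_mono)
    show "integrable lborel (\<lambda>r. indicator {0..} r *\<^sub>R (q r * \<phi> r))"
      by (intro integrable_mult_indicator q\<phi>_int) simp
    show "integrable lborel (\<lambda>r. p r * \<phi> r)"
      using integrable_mult_indicator[OF _ q\<phi>_int, of "{0..L}"] by (simp add: p_def mult_ac)
    show "indicator {0..} r *\<^sub>R (q r * \<phi> r) \<le> p r * \<phi> r" for r
    proof (cases "r > L")
      case True
      then have "q r \<ge> 0" "F r \<le> 0" "r \<ge> 0"
        using q_nonneg[of r] F_nonpos[of r] L by auto
      then show ?thesis
        using True by (simp add: p_def \<phi>_def mult_nonneg_nonpos)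
    next
      case False
      then have "indicator {0..} r = (indicator {0..L} r :: real)"
        by (simp add: indicator_def)
      then show ?thesis by (simp add: p_def)
    qed
  qed
  finally have "(\<integral>r. r\<^sup>2 * F r \<partial>lborel) \<le> 2 * (\<integral>r. p r * \<phi> r \<partial>lborel)"
    by simp
  from mult_left_mono[OF this C] main shells show ?thesis by simp
qed

section \<open>The profile of an admissible function\<close>

lemma integrable_inverse_one_plus_square: "integrable lborel (\<lambda>x :: real. inverse (1 + x\<^sup>2))"
  using integrable_inverse_1_plus_square by (simp add: set_integrable_def)

text \<open>Decay of order four suffices: these inequalities give the integrability of \<open>t F(t)\<close> and \<open>t\<^sup>2 F(t)\<close> by comparison with
\<open>1 / (1 + t\<^sup>2)\<close>, and the boundedness of \<open>F(t)\<close> and \<open>t F(t)\<close>.\<close>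

lemma power4_one_plus_abs_bounds:
  fixes t :: real
  shows "(1 + t\<^sup>2) * t\<^sup>2 \<le> (1 + \<bar>t\<bar>) ^ 4" and "(1 + t\<^sup>2) * \<bar>t\<bar> \<le> (1 + \<bar>t\<bar>) ^ 4"
    and "1 \<le> (1 + \<bar>t\<bar>) ^ 4" and "\<bar>t\<bar> \<le> (1 + \<bar>t\<bar>) ^ 4"
proof -
  have eq: "(1 + \<bar>t\<bar>) ^ 4 = 1 + 4 * \<bar>t\<bar> + 6 * t\<^sup>2 + 4 * (\<bar>t\<bar> * t\<^sup>2) + t\<^sup>2 * t\<^sup>2"
  proof -
    have "(1 + u) ^ 4 = 1 + 4 * u + 6 * u\<^sup>2 + 4 * (u * u\<^sup>2) + u\<^sup>2 * u\<^sup>2" for u :: real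
      by (simp add: power2_eq_square power4_eq_xxxx algebra_simps)
    from this[of "\<bar>t\<bar>"] show ?thesis by simp
  qed
  have nn: "0 \<le> \<bar>t\<bar> * t\<^sup>2" "0 \<le> t\<^sup>2 * t\<^sup>2" "0 \<le> t\<^sup>2" by auto
  show "(1 + t\<^sup>2) * t\<^sup>2 \<le> (1 + \<bar>t\<bar>) ^ 4" "1 \<le> (1 + \<bar>t\<bar>) ^ 4" "\<bar>t\<bar> \<le> (1 + \<bar>t\<bar>) ^ 4"
    using nn unfolding eq by (auto simp: distrib_right)
  have "(1 + t\<^sup>2) * \<bar>t\<bar> = \<bar>t\<bar> + \<bar>t\<bar> * t\<^sup>2" by (simp add: algebra_simps)
  then show "(1 + t\<^sup>2) * \<bar>t\<bar> \<le> (1 + \<bar>t\<bar>) ^ 4"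
    using nn unfolding eq by linarith
qed

lemma fourier_axis_radial:
  fixes f :: "real ^ 3 \<Rightarrow> real" and G :: "real \<Rightarrow> real"
  assumes f: "\<And>x. f x = G (norm x)" and G: "continuous_on UNIV G" "\<And>t. G (- t) = G t"
    and int: "integrable lborel (\<lambda>\<rho>. \<rho>\<^sup>2 * G \<rho>)"
  shows "Re (fourier f 0) = 2 * pi * (\<integral>\<rho>. \<rho>\<^sup>2 * G \<rho> \<partial>lborel)"
    and "s > 0 \<Longrightarrow> Re (fourier f (axis 1 (s / (2 * pi)))) = 2 * pi / s * (\<integral>\<rho>. \<rho> * G \<rho> * sin (s * \<rho>) \<partial>lborel)"
proof -
  have const: "(\<integral>a. 1 * indicator {-\<rho>..\<rho>} a \<partial>lborel) = 2 * \<rho>" if "\<rho> \<ge> 0" for \<rho> :: real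
    using that by simp
  have f_int: "integrable lborel f"
    using integral_norm_coordinate(1)[of G "\<lambda>_. 1" "\<lambda>\<rho>. 2 * \<rho>", OF G(1) _ _ int const G(2)]
    by (simp add: fun_eq_iff[THEN iffD2, OF allI, OF f])
  have Re: "Re (fourier f y) = (\<integral>x. f x * cos (2 * pi * (x \<bullet> y)) \<partial>lborel)" for y
  proof -
    have "integrable lborel (\<lambda>x. complex_of_real (f x) * exp (- 2 * complex_of_real pi * \<i> * complex_of_real (x \<bullet> y)))"
    proof (rule Bochner_Integration.integrable_bound[OF f_int])
      show "(\<lambda>x. complex_of_real (f x) * exp (- 2 * complex_of_real pi * \<i> * complex_of_real (x \<bullet> y))) \<in> borel_measurable lborel"
        using f_int by measurable
    qed (simp add: norm_mult)
    from integral_Re[OF this] show ?thesis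
      by (simp add: fourier_def Re_exp mult.assoc)
  qed
  show "Re (fourier f 0) = 2 * pi * (\<integral>\<rho>. \<rho>\<^sup>2 * G \<rho> \<partial>lborel)"
  proof -
    have "Re (fourier f 0) = pi * (\<integral>\<rho>. \<rho> * G \<rho> * (2 * \<rho>) \<partial>lborel)"
      using integral_norm_coordinate(2)[of G "\<lambda>_. 1" "\<lambda>\<rho>. 2 * \<rho>", OF G(1) _ _ int const G(2)]
      by (simp add: Re f)
    also have "(\<integral>\<rho>. \<rho> * G \<rho> * (2 * \<rho>) \<partial>lborel) = (\<integral>\<rho>. 2 * (\<rho>\<^sup>2 * G \<rho>) \<partial>lborel)"
      by (intro Bochner_Integration.integral_cong) (auto simp: power2_eq_square)
    finally show ?thesis by simp
  qed
  assume s: "s > 0"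
  have inner: "(\<integral>a. cos (s * a) * indicator {-\<rho>..\<rho>} a \<partial>lborel) = 2 * sin (s * \<rho>) / s" if "\<rho> \<ge> 0" for \<rho>
  proof -
    have "(\<integral>a. cos (s * a) * indicator {-\<rho>..\<rho>} a \<partial>lborel) = sin (s * \<rho>) / s - sin (s * (- \<rho>)) / s"
      by (rule integral_FTC_Icc_real) (use that s in \<open>auto intro!: derivative_eq_intros\<close>)
    then show ?thesis by simp
  qed
  have "Re (fourier f (axis 1 (s / (2 * pi)))) = (\<integral>x. G (norm x) * cos (s * x $ 1) \<partial>(lborel :: (real^3) measure))"
    by (simp add: Re f inner_axis mult.commute)
  also have "\<dots> = pi * (\<integral>\<rho>. \<rho> * G \<rho> * (2 * sin (s * \<rho>) / s) \<partial>lborel)"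
    by (rule integral_norm_coordinate(2)[OF G(1) _ _ int inner G(2)]) (auto intro!: continuous_intros)
  also have "\<dots> = pi * (\<integral>\<rho>. 2 / s * (\<rho> * G \<rho> * sin (s * \<rho>)) \<partial>lborel)"
    by (intro arg_cong[where f = "\<lambda>z. pi * z"] Bochner_Integration.integral_cong) auto
  finally show "Re (fourier f (axis 1 (s / (2 * pi)))) = 2 * pi / s * (\<integral>\<rho>. \<rho> * G \<rho> * sin (s * \<rho>) \<partial>lborel)"
    by simp
qed

lemma axis_eq_scaleR: "axis i t = t *\<^sub>R (axis i 1 :: real^'n)"
  by (simp add: axis_def vec_eq_iff)

lemma norm_axis_real: "norm (axis i t :: real^'n) = \<bar>t\<bar>"
  by (subst axis_eq_scaleR) simp

text \<open>The passage from an admissible function on three-space to its profile, rescaled so that the sign condition starts at radius 1.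
Under this rescaling the integral over three-space picks up the factor \<open>r\<^sup>3\<close>.\<close>

lemma admissible_profile:
  fixes f :: "real ^ 3 \<Rightarrow> real"
  assumes adm: "cohn_elkies_admissible r f" and r: "r > 0"
  obtains F K where "continuous_on UNIV F" "\<And>t. F (- t) = F t" "\<And>t. \<bar>F t\<bar> \<le> K" "\<And>t. \<bar>t * F t\<bar> \<le> K"
    "integrable lborel (\<lambda>t. t * F t)" "integrable lborel (\<lambda>t. t\<^sup>2 * F t)"
    "\<And>x. x > 0 \<Longrightarrow> 0 \<le> (\<integral>t. t * F t * sin (x * t) \<partial>lborel)"
    "\<And>t. t \<ge> 1 \<Longrightarrow> F t \<le> 0" "F 0 = f 0" "1 \<le> 2 * pi * (r ^ 3 * (\<integral>t. t\<^sup>2 * F t \<partial>lborel))"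
proof -
  define G where "G = (\<lambda>t. f (axis 1 t))"
  define F where "F = (\<lambda>t. G (r * t))"
  have rad: "f x = f y" if "norm x = norm y" for x y
    using adm that unfolding cohn_elkies_admissible_def radial_def by blast
  have f: "f x = G (norm x)" for x
    unfolding G_def by (rule rad) (simp add: norm_axis_real)
  have "Ck 0 f"
    using adm unfolding cohn_elkies_admissible_def smooth_def by blast
  then have f_cont: "continuous_on UNIV f" by simp
  have G_cont: "continuous_on UNIV G"
  proof -
    have "continuous_on UNIV (\<lambda>t :: real. t *\<^sub>R (axis 1 1 :: real^3))"
      by (intro continuous_intros)
    also have "(\<lambda>t :: real. t *\<^sub>R (axis 1 1 :: real^3)) = axis 1"
      by (simp add: fun_eq_iff axis_eq_scaleR[of 1, symmetric])
    finally show ?thesis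
      unfolding G_def by (intro continuous_on_compose2[OF f_cont]) auto
  qed
  have F_cont: "continuous_on UNIV F"
    unfolding F_def by (intro continuous_on_compose2[OF G_cont] continuous_intros) auto
  have G_even: "G (- t) = G t" for t
    unfolding G_def by (rule rad) (simp add: norm_axis_real)
  obtain B where B: "\<And>x. \<bar>f x\<bar> \<le> B / (1 + norm x) ^ 4"
    using adm unfolding cohn_elkies_admissible_def rapidly_decreasing_def by (meson zero_less_numeral)
  have G_bound: "\<bar>G t\<bar> \<le> B / (1 + \<bar>t\<bar>) ^ 4" for t
    using B[of "axis 1 t"] by (simp add: G_def norm_axis_real)
  have "B \<ge> 0" using G_bound[of 0] by simp
  have decay: "\<bar>G t * m\<bar> \<le> B * inverse w" if "w * \<bar>m\<bar> \<le> (1 + \<bar>t\<bar>) ^ 4" "w > 0" for t m w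
  proof -
    have pos: "(1 + \<bar>t\<bar>) ^ 4 > 0" by simp
    have "\<bar>G t * m\<bar> \<le> B / (1 + \<bar>t\<bar>) ^ 4 * \<bar>m\<bar>"
      unfolding abs_mult by (intro mult_right_mono G_bound) simp
    also have "\<dots> = B * (\<bar>m\<bar> / (1 + \<bar>t\<bar>) ^ 4)" by simp
    also have "\<dots> \<le> B * inverse w"
      using that pos \<open>B \<ge> 0\<close>
      by (intro mult_left_mono) (simp_all add: divide_simps mult.commute)
    finally show ?thesis .
  qed
  have meas [measurable]: "G \<in> borel_measurable borel"
    using G_cont by (rule borel_measurable_continuous_onI)
  have maj: "integrable lborel (\<lambda>t. B * inverse (1 + t\<^sup>2))"
    using integrable_inverse_one_plus_square by simp
  have G_int1: "integrable lborel (\<lambda>t. t * G t)"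
  proof (rule Bochner_Integration.integrable_bound[OF maj])
    have "norm (t * G t) \<le> norm (B * inverse (1 + t\<^sup>2))" for t
      using decay[of "1 + t\<^sup>2" t t] power4_one_plus_abs_bounds(2)[of t] \<open>B \<ge> 0\<close>
      by (simp add: mult.commute add_pos_nonneg)
    then show "AE t in lborel. norm (t * G t) \<le> norm (B * inverse (1 + t\<^sup>2))" by simp
  qed simp
  have G_int2: "integrable lborel (\<lambda>t. t\<^sup>2 * G t)"
  proof (rule Bochner_Integration.integrable_bound[OF maj])
    have "norm (t\<^sup>2 * G t) \<le> norm (B * inverse (1 + t\<^sup>2))" for t
      using decay[of "1 + t\<^sup>2" "t\<^sup>2" t] power4_one_plus_abs_bounds(1)[of t] \<open>B \<ge> 0\<close>
      by (simp add: mult.commute add_pos_nonneg)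
    then show "AE t in lborel. norm (t\<^sup>2 * G t) \<le> norm (B * inverse (1 + t\<^sup>2))" by simp
  qed simp
  define K where "K = max B (B / r)"
  show thesis
  proof (rule that[of F K])
    show "continuous_on UNIV F" by (rule F_cont)
    show "F (- t) = F t" for t by (simp add: F_def G_even)
    show "\<bar>F t\<bar> \<le> K" for t
      using decay[of 1 1 "r * t"] power4_one_plus_abs_bounds(3)[of "r * t"] by (simp add: F_def K_def)
    show "\<bar>t * F t\<bar> \<le> K" for t
    proof -
      have "r * \<bar>t * F t\<bar> = \<bar>G (r * t) * (r * t)\<bar>"
        using r by (simp add: F_def abs_mult)
      also have "\<dots> \<le> B"
        using decay[of 1 "r * t" "r * t"] power4_one_plus_abs_bounds(4)[of "r * t"] by simp
      finally have "\<bar>t * F t\<bar> \<le> B / r" using r by (simp add: field_simps)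
      then show ?thesis by (simp add: K_def)
    qed
    have "integrable lborel (\<lambda>t. (0 + r * t) * G (0 + r * t))" "integrable lborel (\<lambda>t. (0 + r * t)\<^sup>2 * G (0 + r * t))"
      using lborel_integrable_real_affine[OF G_int1, of r 0] lborel_integrable_real_affine[OF G_int2, of r 0] r by auto
    then have "integrable lborel (\<lambda>t. r * (t * F t))" "integrable lborel (\<lambda>t. r\<^sup>2 * (t\<^sup>2 * F t))"
      by (simp_all add: F_def mult.assoc power_mult_distrib)
    then show "integrable lborel (\<lambda>t. t * F t)" "integrable lborel (\<lambda>t. t\<^sup>2 * F t)"
      using r by simp_all
    show "0 \<le> (\<integral>t. t * F t * sin (x * t) \<partial>lborel)" if "x > 0" for x
    proof -
      have "0 \<le> Re (fourier f (axis 1 (x / r / (2 * pi))))"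
        using adm unfolding cohn_elkies_admissible_def by blast
      also have "\<dots> = 2 * pi / (x / r) * (\<integral>\<rho>. \<rho> * G \<rho> * sin (x / r * \<rho>) \<partial>lborel)"
        using fourier_axis_radial(2)[OF f G_cont G_even G_int2, of "x / r"] that r by simp
      also have "(\<integral>\<rho>. \<rho> * G \<rho> * sin (x / r * \<rho>) \<partial>lborel)
          = \<bar>r\<bar> *\<^sub>R (\<integral>t. (0 + r * t) * G (0 + r * t) * sin (x / r * (0 + r * t)) \<partial>lborel)"
        using r by (intro lborel_integral_real_affine) simp
      also have "\<dots> = r\<^sup>2 * (\<integral>t. t * F t * sin (x * t) \<partial>lborel)"
        using r by (simp add: F_def power2_eq_square mult.assoc)
      finally have "0 \<le> (2 * pi / (x / r) * r\<^sup>2) * (\<integral>t. t * F t * sin (x * t) \<partial>lborel)"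
        by (simp only: mult.assoc)
      moreover have "0 < 2 * pi / (x / r) * r\<^sup>2" using that r by simp
      ultimately show ?thesis by (meson mult_pos_neg not_le)
    qed
    show "F t \<le> 0" if "t \<ge> 1" for t
    proof -
      have "r \<le> norm (axis 1 (r * t) :: real^3)" using that r by (simp add: norm_axis_real abs_mult)
      then show ?thesis
        using adm unfolding cohn_elkies_admissible_def F_def G_def by blast
    qed
    show "F 0 = f 0"
      using f[of 0] by (simp add: F_def)
    have "1 \<le> Re (fourier f 0)"
      using adm unfolding cohn_elkies_admissible_def by blast
    also have "\<dots> = 2 * pi * (\<integral>\<rho>. \<rho>\<^sup>2 * G \<rho> \<partial>lborel)"
      by (rule fourier_axis_radial(1)[OF f G_cont G_even G_int2])
    also have "(\<integral>\<rho>. \<rho>\<^sup>2 * G \<rho> \<partial>lborel) = \<bar>r\<bar> *\<^sub>R (\<integral>t. (0 + r * t)\<^sup>2 * G (0 + r * t) \<partial>lborel)"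
      using r by (intro lborel_integral_real_affine) simp
    also have "(\<integral>t. (0 + r * t)\<^sup>2 * G (0 + r * t) \<partial>lborel) = (\<integral>t. r\<^sup>2 * (t\<^sup>2 * F t) \<partial>lborel)"
      by (simp add: F_def power_mult_distrib mult.assoc)
    also have "\<bar>r\<bar> *\<^sub>R \<dots> = r ^ 3 * (\<integral>t. t\<^sup>2 * F t \<partial>lborel)"
      using r by (simp add: power3_eq_cube power2_eq_square mult.assoc)
    finally show "1 \<le> 2 * pi * (r ^ 3 * (\<integral>t. t\<^sup>2 * F t \<partial>lborel))" .
  qed
qed

section \<open>The certificate in closed form\<close>

text \<open>The numbers of the certificate: tail starting at \<open>L = 1.56\<close>, shells in frequency at \<open>\<xi> = 8.18, 13.105\<close> with
weights \<open>1.63, 0.965\<close>, shells in space at radii \<open>1, 1.56\<close> with weights \<open>13.224, 2.47\<close>, and \<open>C = 18.5\<close>. They come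
from a linear program in the weights for fixed \<open>L\<close> and \<open>\<xi>\<close>, followed by a search over the latter. The best
value of \<open>C\<close> for this shape is about \<open>18.64\<close>; the bound needs \<open>C > 18.496\<close>. The difference was
spent on keeping the transform away from zero, so that it can be checked on a coarse grid.\<close>

definition tail_weight :: "real \<Rightarrow> real" where
  "tail_weight r = r + (163/100) * sin ((818/100) * r) + (965/1000) * sin ((13105/1000) * r)"

definition dual_transform :: "real \<Rightarrow> real" where
  "dual_transform x = x + (13224/1000) * sin x + (247/100) * sin ((156/100) * x)
     - (185/10) * (\<integral>r. tail_weight r * indicator {0..156/100} r * sin (x * r) \<partial>lborel)"

lemma pi_bounds: "314159/100000 < pi" "pi < 31416/10000"
proof -
  show "314159/100000 < pi" by (rule less_le_trans[OF _ pi_approx(1)]) simp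
  show "pi < 31416/10000" by (rule le_less_trans[OF pi_approx(2)]) simp
qed

lemma sin_nonneg_between:
  assumes "2 * real k * pi \<le> x" "x \<le> (2 * real k + 1) * pi"
  shows "0 \<le> sin x"
proof -
  have "sin x = sin (x - 2 * real k * pi + 2 * real k * pi)" by simp
  also have "\<dots> = sin (x - 2 * real k * pi)"
    by (simp only: sin_add cos_2npi sin_2npi mult_1_right mult_zero_right add_0_right)
  also have "\<dots> \<ge> 0"
    using assms by (intro sin_ge_zero) (auto simp: algebra_simps)
  finally show ?thesis .
qed

text \<open>Beyond \<open>1.56\<close> the two sines are never both close to \<open>-1\<close>. The first is nonnegative on \<open>[4\<pi>, 5\<pi>]\<close> and
on \<open>[6\<pi>, 7\<pi>]\<close>, the second on \<open>[8\<pi>, 9\<pi>]\<close>, and where one sine is nonnegative \<open>r\<close> exceeds the weight of the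
other. Only the short gap between \<open>r = 9\<pi> / 13.105\<close> and \<open>r = 6\<pi> / 8.18\<close> remains, in which both are
negative but near a zero; past \<open>7\<pi> / 8.18\<close> the variable \<open>r\<close> exceeds the sum of both weights.\<close>

lemma tail_weight_nonneg:
  assumes r: "r \<ge> (156/100)"
  shows "tail_weight r \<ge> 0"
proof -
  have s: "- 1 \<le> sin ((818/100) * r)" "- 1 \<le> sin ((13105/1000) * r)" by simp_all
  consider "(818/100) * r \<le> 5 * pi" | "5 * pi \<le> (818/100) * r" "(13105/1000) * r \<le> 9 * pi"
    | "9 * pi \<le> (13105/1000) * r" "(818/100) * r \<le> 6 * pi" | "6 * pi \<le> (818/100) * r" "(818/100) * r \<le> 7 * pi"
    | "7 * pi \<le> (818/100) * r" by linarith
  then show ?thesis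
  proof cases
    case 1
    have "0 \<le> sin ((818/100) * r)"
      by (rule sin_nonneg_between[of 2]) (use 1 r pi_bounds in auto)
    then show ?thesis using s(2) r unfolding tail_weight_def by linarith
  next
    case 2
    have "0 \<le> sin ((13105/1000) * r)"
      by (rule sin_nonneg_between[of 4]) (use 2 pi_bounds in auto)
    then show ?thesis using s(1) 2 pi_bounds unfolding tail_weight_def by linarith
  next
    case 3
    have "sin ((818/100) * r) = - sin (6 * pi - (818/100) * r)"
      using sin_periodic_pi[of "(818/100) * r - 3 * pi"] sin_2npi[of 3] cos_2npi[of 3]
      by (simp add: sin_diff mult.commute)
    moreover have "sin (6 * pi - (818/100) * r) \<le> 6 * pi - (818/100) * r"
      using 3 by (intro sin_x_le_x) simp
    ultimately have b1: "sin ((818/100) * r) \<ge> (818/100) * r - 6 * pi" by simp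
    have "sin ((13105/1000) * r) = - sin ((13105/1000) * r - 9 * pi)"
      using sin_npi[of 9] cos_npi[of 9] by (simp add: sin_diff)
    moreover have "sin ((13105/1000) * r - 9 * pi) \<le> (13105/1000) * r - 9 * pi"
      using 3 by (intro sin_x_le_x) simp
    ultimately have b2: "sin ((13105/1000) * r) \<ge> 9 * pi - (13105/1000) * r" by simp
    show ?thesis
    proof (cases "r \<le> (219/100)")
      case True
      then show ?thesis using s b2 pi_bounds unfolding tail_weight_def by linarith
    next
      case False
      then show ?thesis using b1 b2 pi_bounds unfolding tail_weight_def by linarith
    qed
  next
    case 4
    have "0 \<le> sin ((818/100) * r)"
      by (rule sin_nonneg_between[of 3]) (use 4 in auto)
    then show ?thesis using s(2) r unfolding tail_weight_def by linarith
  next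
    case 5
    then show ?thesis using s pi_bounds unfolding tail_weight_def by linarith
  qed
qed

lemma quotient_bound:
  fixes k x \<alpha> \<beta> \<gamma> :: real
  assumes "k > 0" "x > 0" "\<bar>\<alpha>\<bar> \<le> \<gamma>" "\<bar>\<beta>\<bar> \<le> \<gamma>" "\<delta> > 0" "\<delta> \<le> \<bar>x - k\<bar>"
  shows "\<bar>(k * \<alpha> - x * \<beta>) / (x\<^sup>2 - k\<^sup>2)\<bar> \<le> \<gamma> / \<delta>"
proof -
  have "\<gamma> \<ge> 0" using assms(3) by linarith
  have "\<bar>k * \<alpha> - x * \<beta>\<bar> \<le> \<bar>k * \<alpha>\<bar> + \<bar>x * \<beta>\<bar>" by (rule abs_triangle_ineq4)
  also have "\<dots> \<le> k * \<gamma> + x * \<gamma>"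
    using assms by (auto simp: abs_mult intro!: add_mono mult_left_mono)
  finally have num: "\<bar>k * \<alpha> - x * \<beta>\<bar> \<le> \<gamma> * (x + k)" by (simp add: algebra_simps)
  have "x\<^sup>2 - k\<^sup>2 = (x - k) * (x + k)" by (simp add: power2_eq_square algebra_simps)
  then have "\<bar>(k * \<alpha> - x * \<beta>) / (x\<^sup>2 - k\<^sup>2)\<bar> = \<bar>k * \<alpha> - x * \<beta>\<bar> / (\<bar>x - k\<bar> * (x + k))"
    using assms by (simp add: abs_divide abs_mult)
  also have "\<dots> \<le> \<gamma> * (x + k) / (\<bar>x - k\<bar> * (x + k))"
    using num assms by (intro divide_right_mono) auto
  also have "\<dots> = \<gamma> / \<bar>x - k\<bar>" using assms by simp
  also have "\<dots> \<le> \<gamma> / \<delta>" using assms \<open>\<gamma> \<ge> 0\<close> by (intro divide_left_mono) auto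
  finally show ?thesis .
qed

lemma sin_product_integral:
  fixes k x L :: real
  assumes "L \<ge> 0" "x\<^sup>2 \<noteq> k\<^sup>2"
  shows "has_bochner_integral lborel (\<lambda>r. sin (k * r) * sin (x * r) * indicator {0..L} r)
    ((k * cos (k * L) * sin (x * L) - x * sin (k * L) * cos (x * L)) / (x\<^sup>2 - k\<^sup>2))"
proof -
  have ne: "x\<^sup>2 - k\<^sup>2 \<noteq> 0" using assms by simp
  have "has_bochner_integral lborel (\<lambda>r. sin (k * r) * sin (x * r) * indicator {0..L} r)
    ((k * cos (k * L) * sin (x * L) - x * sin (k * L) * cos (x * L)) / (x\<^sup>2 - k\<^sup>2)
    - (k * cos (k * 0) * sin (x * 0) - x * sin (k * 0) * cos (x * 0)) / (x\<^sup>2 - k\<^sup>2))"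
  proof (rule has_bochner_integral_FTC_Icc_real[OF \<open>L \<ge> 0\<close>])
    fix r :: real
    have "((\<lambda>r. k * cos (k * r) * sin (x * r) - x * sin (k * r) * cos (x * r)) has_real_derivative
        (x\<^sup>2 - k\<^sup>2) * (sin (k * r) * sin (x * r))) (at r)"
      by (auto intro!: derivative_eq_intros simp: algebra_simps power2_eq_square)
    from DERIV_cdivide[OF this, of "x\<^sup>2 - k\<^sup>2"] ne
    show "((\<lambda>r. (k * cos (k * r) * sin (x * r) - x * sin (k * r) * cos (x * r)) / (x\<^sup>2 - k\<^sup>2)) has_real_derivative
        sin (k * r) * sin (x * r)) (at r)" by simp
  qed simp
  then show ?thesis by simp
qed

lemma id_sin_integral:
  fixes x L :: real
  assumes "L \<ge> 0" "x \<noteq> 0"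
  shows "has_bochner_integral lborel (\<lambda>r. r * sin (x * r) * indicator {0..L} r)
    ((sin (x * L) - x * L * cos (x * L)) / x\<^sup>2)"
proof -
  have "has_bochner_integral lborel (\<lambda>r. r * sin (x * r) * indicator {0..L} r)
    ((sin (x * L) - x * L * cos (x * L)) / x\<^sup>2 - (sin (x * 0) - x * 0 * cos (x * 0)) / x\<^sup>2)"
  proof (rule has_bochner_integral_FTC_Icc_real[OF \<open>L \<ge> 0\<close>])
    fix r :: real
    have "((\<lambda>r. sin (x * r) - x * r * cos (x * r)) has_real_derivative x\<^sup>2 * (r * sin (x * r))) (at r)"
      by (auto intro!: derivative_eq_intros simp: algebra_simps power2_eq_square)
    from DERIV_cdivide[OF this, of "x\<^sup>2"] assms
    show "((\<lambda>r. (sin (x * r) - x * r * cos (x * r)) / x\<^sup>2) has_real_derivative r * sin (x * r)) (at r)" by simp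
  qed simp
  then show ?thesis by simp
qed

text \<open>The transform with the integral worked out, as a function of separate arguments for the trigonometric values: \<open>c1, s1, c2, s2\<close> are
cosine and sine of \<open>1.56 * 8.18 = 12.7608\<close> and of \<open>1.56 * 13.105 = 20.4438\<close>, while \<open>s, u, v\<close> are \<open>sin x\<close>,
\<open>sin (1.56 x)\<close> and \<open>cos (1.56 x)\<close>. Rational approximations can then be substituted for them.\<close>

definition dual_transform_closed :: "real \<Rightarrow> real \<Rightarrow> real \<Rightarrow> real \<Rightarrow> real \<Rightarrow> real \<Rightarrow> real \<Rightarrow> real \<Rightarrow> real" where
  "dual_transform_closed c1 s1 c2 s2 x s u v = x + (13224/1000) * s + (247/100) * u
     - (185/10) * ((u - (156/100) * x * v) / x\<^sup>2
         + (163/100) * (((818/100) * c1 * u - x * s1 * v) / (x\<^sup>2 - (818/100)\<^sup>2))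
         + (965/1000) * (((13105/1000) * c2 * u - x * s2 * v) / (x\<^sup>2 - (13105/1000)\<^sup>2)))"

lemma dual_transform_eq_closed:
  assumes "x > 0" "x \<noteq> (818/100)" "x \<noteq> (13105/1000)"
  shows "dual_transform x = dual_transform_closed (cos (127608/10000)) (sin (127608/10000)) (cos (204438/10000)) (sin (204438/10000))
    x (sin x) (sin ((156/100) * x)) (cos ((156/100) * x))"
proof -
  have ne: "x\<^sup>2 \<noteq> (818/100)\<^sup>2" "x\<^sup>2 \<noteq> (13105/1000)\<^sup>2"
    using assms by (auto simp: power2_eq_iff)
  have eq: "tail_weight r * indicator {0..156/100} r * sin (x * r) = r * sin (x * r) * indicator {0..156/100} r
      + (163/100) * (sin ((818/100) * r) * sin (x * r) * indicator {0..156/100} r)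
      + (965/1000) * (sin ((13105/1000) * r) * sin (x * r) * indicator {0..156/100} r)" for r
    by (simp add: tail_weight_def algebra_simps)
  have "has_bochner_integral lborel (\<lambda>r. tail_weight r * indicator {0..156/100} r * sin (x * r))
     ((sin (x * (156/100)) - x * (156/100) * cos (x * (156/100))) / x\<^sup>2
      + (163/100) * (((818/100) * cos ((818/100) * (156/100)) * sin (x * (156/100)) - x * sin ((818/100) * (156/100)) * cos (x * (156/100))) / (x\<^sup>2 - (818/100)\<^sup>2))
      + (965/1000) * (((13105/1000) * cos ((13105/1000) * (156/100)) * sin (x * (156/100)) - x * sin ((13105/1000) * (156/100)) * cos (x * (156/100))) / (x\<^sup>2 - (13105/1000)\<^sup>2)))"
    unfolding eq
    by (intro has_bochner_integral_add has_bochner_integral_mult_right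
        id_sin_integral[where x = x] sin_product_integral[where x = x] ne) (use assms in auto)
  from has_bochner_integral_integral_eq[OF this] show ?thesis
    by (simp add: dual_transform_def dual_transform_closed_def mult.commute)
qed

text \<open>The linear term wins: both shells contribute at most \<open>13.224 + 2.47\<close>, and the integral decays like \<open>1 / x\<close>.\<close>

lemma dual_transform_nonneg_large:
  assumes "x \<ge> 24"
  shows "dual_transform x \<ge> 0"
proof -
  have prod: "\<bar>a * b\<bar> \<le> 1" if "\<bar>a\<bar> \<le> 1" "\<bar>b\<bar> \<le> 1" for a b :: real
    using that by (simp add: abs_mult mult_le_one)
  define N1 where "N1 = (sin ((156/100) * x) - (156/100) * x * cos ((156/100) * x)) / x\<^sup>2"
  define N2 where "N2 = ((818/100) * cos (127608/10000) * sin ((156/100) * x) - x * sin (127608/10000) * cos ((156/100) * x)) / (x\<^sup>2 - (818/100)\<^sup>2)"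
  define N3 where "N3 = ((13105/1000) * cos (204438/10000) * sin ((156/100) * x) - x * sin (204438/10000) * cos ((156/100) * x)) / (x\<^sup>2 - (13105/1000)\<^sup>2)"
  have expand: "dual_transform x = x + (13224/1000) * sin x + (247/100) * sin ((156/100) * x) - (185/10) * (N1 + (163/100) * N2 + (965/1000) * N3)"
    using assms by (subst dual_transform_eq_closed) (auto simp: dual_transform_closed_def N1_def N2_def N3_def)
  have "\<bar>N2\<bar> \<le> 1 / 15" "\<bar>N3\<bar> \<le> 1 / 10"
    unfolding N2_def N3_def mult.assoc[of _ "cos _"] mult.assoc[of _ "sin _"]
    using assms by (intro quotient_bound prod; simp)+
  then have N23: "N2 \<le> 1 / 15" "N3 \<le> 1 / 10" by linarith+
  have "\<bar>a * b\<bar> \<le> a" if "0 \<le> a" "\<bar>b\<bar> \<le> 1" for a b :: real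
    using that by (simp add: abs_mult mult_left_le)
  from this[of "(156/100) * x" "cos ((156/100) * x)"]
  have "\<bar>(156/100) * x * cos ((156/100) * x)\<bar> \<le> (156/100) * x"
    using assms by simp
  then have "\<bar>sin ((156/100) * x) - (156/100) * x * cos ((156/100) * x)\<bar> \<le> 1 + (156/100) * x"
    using abs_triangle_ineq4[of "sin ((156/100) * x)" "(156/100) * x * cos ((156/100) * x)"]
      abs_sin_le_one[of "(156/100) * x"] by linarith
  then have "N1 \<le> (1 + (156/100) * x) / x\<^sup>2"
    unfolding N1_def by (intro divide_right_mono) auto
  also have "\<dots> \<le> (1/10)"
  proof -
    have "24 * x \<le> x * x" using assms by (intro mult_right_mono) auto
    then have "1 + (156/100) * x \<le> (1/10) * (x * x)" using assms by linarith
    moreover have "x\<^sup>2 > 0" using assms by simp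
    ultimately show ?thesis by (simp only: pos_divide_le_eq power2_eq_square)
  qed
  finally have "N1 \<le> 1/10" .
  moreover have "- 1 \<le> sin x" "- 1 \<le> sin ((156/100) * x)" by simp_all
  moreover have "185/10 * (N1 + 163/100 * N2 + 965/1000 * N3)
      \<le> 185/10 * (1/10 + 163/100 * (1/15) + 965/1000 * (1/10))"
    using N23 \<open>N1 \<le> 1/10\<close> by (intro mult_left_mono add_mono) simp_all
  moreover have "185/10 * (1/10 + 163/100 * (1/15) + 965/1000 * (1/10)) \<le> (6 :: real)" by simp
  ultimately show ?thesis using assms unfolding expand by linarith
qed

section \<open>Interpolation of the transform\<close>

text \<open>If \<open>f'' \<ge> - B\<close>, then \<open>f(x) + B x\<^sup>2 / 2\<close> is convex and lies below its chord.\<close>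

lemma chord_bound:
  fixes f f' f'' :: "real \<Rightarrow> real"
  assumes "a \<le> b" "0 \<le> t" "t \<le> 1"
    and f': "\<And>x. (f has_real_derivative f' x) (at x)"
    and f'': "\<And>x. (f' has_real_derivative f'' x) (at x)"
    and B: "\<And>x. a \<le> x \<Longrightarrow> x \<le> b \<Longrightarrow> - B \<le> f'' x"
  shows "f ((1 - t) * a + t * b) \<le> (1 - t) * f a + t * f b + B / 2 * (t * (1 - t) * (b - a)\<^sup>2)"
proof -
  define g where "g = (\<lambda>x. f x + B / 2 * x\<^sup>2)"
  have "convex_on {a..b} g"
  proof (rule f''_ge0_imp_convex)
    show "(g has_real_derivative f' x + B * x) (at x)" for x
      unfolding g_def by (auto intro!: derivative_eq_intros f')
    show "((\<lambda>x. f' x + B * x) has_real_derivative f'' x + B) (at x)" for x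
      by (auto intro!: derivative_eq_intros f'')
    show "f'' x + B \<ge> 0" if "x \<in> {a..b}" for x
      using B[of x] that by simp
  qed simp
  from convex_onD[OF this, of t a b]
  have "g ((1 - t) * a + t * b) \<le> (1 - t) * g a + t * g b"
    using assms by simp
  also have "\<dots> = (1 - t) * f a + t * f b + B / 2 * ((1 - t) * a\<^sup>2 + t * b\<^sup>2)"
    by (simp add: g_def field_simps)
  finally have "f ((1 - t) * a + t * b) \<le> (1 - t) * f a + t * f b
      + B / 2 * ((1 - t) * a\<^sup>2 + t * b\<^sup>2 - ((1 - t) * a + t * b)\<^sup>2)"
    by (simp add: g_def right_diff_distrib)
  also have "(1 - t) * a\<^sup>2 + t * b\<^sup>2 - ((1 - t) * a + t * b)\<^sup>2 = t * (1 - t) * (b - a)\<^sup>2"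
    by (simp add: power2_eq_square algebra_simps)
  finally show ?thesis .
qed

lemma sin_chord_bound:
  fixes a b s t :: real
  assumes ab: "a \<le> b" "0 \<le> t" "t \<le> 1" and B: "\<And>x. a \<le> x \<Longrightarrow> x \<le> b \<Longrightarrow> s\<^sup>2 * \<bar>sin (x * s)\<bar> \<le> B"
  shows "\<bar>(1 - t) * sin (a * s) + t * sin (b * s) - sin (((1 - t) * a + t * b) * s)\<bar>
    \<le> B / 2 * (t * (1 - t) * (b - a)\<^sup>2)"
proof -
  have B': "\<bar>s\<^sup>2 * sin (x * s)\<bar> \<le> B" if "a \<le> x" "x \<le> b" for x
    using B[OF that] by (simp add: abs_mult)
  have d: "((\<lambda>x. sin (x * s)) has_real_derivative s * cos (x * s)) (at x)"
    "((\<lambda>x. s * cos (x * s)) has_real_derivative - (s\<^sup>2 * sin (x * s))) (at x)"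
    "((\<lambda>x. - sin (x * s)) has_real_derivative - (s * cos (x * s))) (at x)"
    "((\<lambda>x. - (s * cos (x * s))) has_real_derivative s\<^sup>2 * sin (x * s)) (at x)" for x
    by (auto intro!: derivative_eq_intros simp: power2_eq_square)
  have "sin (((1 - t) * a + t * b) * s)
      \<le> (1 - t) * sin (a * s) + t * sin (b * s) + B / 2 * (t * (1 - t) * (b - a)\<^sup>2)"
    by (rule chord_bound[OF ab d(1,2)]) (use B' in \<open>force simp: abs_le_iff\<close>)
  moreover have "- sin (((1 - t) * a + t * b) * s)
      \<le> (1 - t) * (- sin (a * s)) + t * (- sin (b * s)) + B / 2 * (t * (1 - t) * (b - a)\<^sup>2)"
    by (rule chord_bound[OF ab d(3,4)]) (use B' in \<open>force simp: abs_le_iff\<close>)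
  ultimately show ?thesis unfolding abs_le_iff by (intro conjI) linarith+
qed

text \<open>The transform is a superposition of the functions \<open>sin (s x)\<close> with \<open>0 \<le> s \<le> 1.56\<close>, apart from a linear term that
interpolation reproduces exactly. So its interpolation error is the superposition of theirs, and the second derivative
of the integral is never formed. The power \<open>m\<close> is left open because two bounds for the second derivative of
\<open>sin (s x)\<close> will be used: \<open>s\<^sup>2\<close>, and \<open>s\<^sup>3 b\<close> for arguments up to \<open>b\<close>, which is smaller near the origin, where the
transform vanishes.\<close>

lemma dual_transform_chord_bound:
  fixes a b t k :: real and m :: nat
  assumes ab: "0 \<le> a" "a \<le> b" "0 \<le> t" "t \<le> 1" and "k \<ge> 0"
    and k: "\<And>s x. 0 \<le> s \<Longrightarrow> a \<le> x \<Longrightarrow> x \<le> b \<Longrightarrow> s\<^sup>2 * \<bar>sin (x * s)\<bar> \<le> k * s ^ m"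
  shows "(1 - t) * dual_transform a + t * dual_transform b - k / 2 * (t * (1 - t) * (b - a)\<^sup>2)
      * (13224/1000 + (247/100) * (156/100) ^ m
        + (185/10) * ((156/100) ^ (m + 2) / (m + 2) + (2595/1000) * ((156/100) ^ (m + 1) / (m + 1))))
    \<le> dual_transform ((1 - t) * a + t * b)"
proof -
  define x where "x = (1 - t) * a + t * b"
  define \<tau> where "\<tau> = k / 2 * (t * (1 - t) * (b - a)\<^sup>2)"
  define D where "D s = (1 - t) * sin (a * s) + t * sin (b * s) - sin (x * s)" for s
  define p where "p = (\<lambda>r. tail_weight r * indicator {0..156/100} r)"
  define N where "N y = (\<integral>r. p r * sin (y * r) \<partial>lborel)" for y
  have \<tau>: "\<tau> \<ge> 0" using assms by (simp add: \<tau>_def)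
  have D: "\<bar>D s\<bar> \<le> \<tau> * s ^ m" if "s \<ge> 0" for s
    using sin_chord_bound[of a b t s "k * s ^ m"] ab k[OF that] by (simp add: D_def x_def \<tau>_def mult_ac)
  have tail_weight_cont: "continuous_on S tail_weight" for S
    unfolding tail_weight_def[abs_def] by (intro continuous_intros)
  have p_int: "integrable lborel p"
    using borel_integrable_atLeastAtMost'[OF tail_weight_cont, of 0 "156/100"]
    by (simp add: p_def set_integrable_def mult.commute)
  have p_sin_int: "integrable lborel (\<lambda>r. p r * sin (y * r))" for y
    by (rule integrable_sin_mult[OF p_int])
  have pD_eq: "p r * D r = (1 - t) * (p r * sin (a * r)) + t * (p r * sin (b * r)) - p r * sin (x * r)" for r
    by (simp add: D_def algebra_simps)
  have pD_int: "integrable lborel (\<lambda>r. p r * D r)"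
    unfolding pD_eq using p_sin_int by simp
  have poly: "has_bochner_integral lborel (\<lambda>r. (r ^ (m + 1) + (2595/1000) * r ^ m) * indicator {0..156/100} r)
      ((156/100) ^ (m + 2) / (m + 2) + (2595/1000) * ((156/100) ^ (m + 1) / (m + 1)))"
  proof -
    have "has_bochner_integral lborel (\<lambda>r. (r ^ (m + 1) + (2595/1000) * r ^ m) * indicator {0..156/100} r)
      (((156/100) ^ (m + 2) / real (m + 2) + (2595/1000) * ((156/100) ^ (m + 1) / real (m + 1)))
       - (0 ^ (m + 2) / real (m + 2) + (2595/1000) * (0 ^ (m + 1) / real (m + 1))))"
    proof (rule has_bochner_integral_FTC_Icc_real)
      fix r :: real
      have power: "((\<lambda>r. r ^ (n + 1) / real (n + 1)) has_real_derivative r ^ n) (at r)" for n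
      proof -
        have "((\<lambda>r. r ^ Suc n) has_real_derivative (1 + real n) * r ^ n) (at r)"
          using DERIV_power_Suc[OF DERIV_ident] by (simp add: mult.commute)
        from DERIV_cdivide[OF this, of "real (Suc n)"] show ?thesis by simp
      qed
      show "((\<lambda>r. r ^ (m + 2) / real (m + 2) + (2595/1000) * (r ^ (m + 1) / real (m + 1))) has_real_derivative
          r ^ (m + 1) + (2595/1000) * r ^ m) (at r)"
        using DERIV_add[OF power[of "m + 1"] DERIV_cmult[OF power[of m], of "2595/1000"]]
        by (simp only: add.assoc one_add_one)
      show "isCont (\<lambda>r. r ^ (m + 1) + (2595/1000) * r ^ m) r"
        by (intro continuous_intros)
    qed simp
    then show ?thesis by simp
  qed
  have "(1 - t) * N a + t * N b - N x = (\<integral>r. p r * D r \<partial>lborel)"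
    unfolding pD_eq N_def using p_sin_int by simp
  also have "\<dots> \<ge> - (\<integral>r. \<tau> * ((r ^ (m + 1) + (2595/1000) * r ^ m) * indicator {0..156/100} r) \<partial>lborel)"
  proof -
    have "\<bar>p r * D r\<bar> \<le> \<tau> * ((r ^ (m + 1) + (2595/1000) * r ^ m) * indicator {0..156/100} r)" for r
    proof (cases "r \<in> {0..156/100}")
      case True
      have "\<bar>tail_weight r\<bar> \<le> r + 2595/1000"
      proof -
        have "- 1 \<le> sin ((818/100) * r)" "sin ((818/100) * r) \<le> 1"
          "- 1 \<le> sin ((13105/1000) * r)" "sin ((13105/1000) * r) \<le> 1" "0 \<le> r"
          using True by simp_all
        then show ?thesis unfolding tail_weight_def by linarith
      qed
      then have "\<bar>tail_weight r\<bar> * \<bar>D r\<bar> \<le> (r + 2595/1000) * (\<tau> * r ^ m)"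
        using D[of r] True by (intro mult_mono) auto
      then show ?thesis using True by (simp add: p_def abs_mult algebra_simps)
    qed (simp add: p_def)
    then have "(\<integral>r. norm (p r * D r) \<partial>lborel)
        \<le> (\<integral>r. \<tau> * ((r ^ (m + 1) + (2595/1000) * r ^ m) * indicator {0..156/100} r) \<partial>lborel)"
      using pD_int integrable.intros[OF poly] by (intro integral_mono integrable_norm integrable_mult_right) simp_all
    from order_trans[OF integral_norm_bound this] have "\<bar>\<integral>r. p r * D r \<partial>lborel\<bar>
        \<le> (\<integral>r. \<tau> * ((r ^ (m + 1) + (2595/1000) * r ^ m) * indicator {0..156/100} r) \<partial>lborel)"
      by (simp only: real_norm_def)
    then show ?thesis by linarith
  qed
  also have "(\<integral>r. \<tau> * ((r ^ (m + 1) + (2595/1000) * r ^ m) * indicator {0..156/100} r) \<partial>lborel)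
      = \<tau> * ((156/100) ^ (m + 2) / (m + 2) + (2595/1000) * ((156/100) ^ (m + 1) / (m + 1)))"
    using has_bochner_integral_integral_eq[OF poly] by simp
  finally have N: "N x \<le> (1 - t) * N a + t * N b
      + \<tau> * ((156/100) ^ (m + 2) / (m + 2) + (2595/1000) * ((156/100) ^ (m + 1) / (m + 1)))"
    by simp
  define c1 c2 c l where "c1 = (13224/1000 :: real)" and "c2 = (247/100 :: real)" and "c = (185/10 :: real)"
    and "l = (156/100 :: real)"
  define P where "P = l ^ (m + 2) / (m + 2) + (2595/1000) * (l ^ (m + 1) / (m + 1))"
  have expand: "dual_transform y = y + c1 * sin y + c2 * sin (l * y) - c * N y" for y
    by (simp add: dual_transform_def N_def p_def c1_def c2_def c_def l_def)
  have N': "N x \<le> (1 - t) * N a + t * N b + \<tau> * P"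
    using N unfolding P_def l_def .
  have D1: "D 1 = (1 - t) * sin a + t * sin b - sin x" by (simp add: D_def)
  have D2: "D l = (1 - t) * sin (l * a) + t * sin (l * b) - sin (l * x)"
    by (simp add: D_def mult.commute)
  have "D 1 \<le> \<tau>" "D l \<le> \<tau> * l ^ m"
    using D[of 1] D[of l] by (auto simp: l_def)
  then have "c1 * D 1 + c2 * D l \<le> c1 * \<tau> + c2 * (\<tau> * l ^ m)"
    by (intro add_mono mult_left_mono) (auto simp: c1_def c2_def)
  moreover have "c * N x \<le> c * ((1 - t) * N a + t * N b + \<tau> * P)"
    using N' by (intro mult_left_mono) (auto simp: c_def)
  ultimately have "(1 - t) * dual_transform a + t * dual_transform b - \<tau> * (c1 + c2 * l ^ m + c * P) \<le> dual_transform x"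
    by (simp add: expand D1 D2 x_def algebra_simps)
  then show ?thesis
    by (simp only: \<tau>_def x_def P_def c1_def c2_def c_def l_def)
qed

text \<open>The two constants of the preceding lemma, for \<open>m = 2\<close> and \<open>m = 3\<close>, are about \<open>107.4\<close> and \<open>127.9\<close>; both are
replaced by \<open>128\<close>.\<close>

lemma dual_transform_chord:
  fixes a b t :: real
  assumes ab: "0 \<le> a" "a \<le> b" "0 \<le> t" "t \<le> 1"
  shows "(1 - t) * dual_transform a + t * dual_transform b - 64 * min 1 b * (t * (1 - t) * (b - a)\<^sup>2) \<le> dual_transform ((1 - t) * a + t * b)"
proof -
  define w where "w = t * (1 - t) * (b - a)\<^sup>2"
  have w: "w \<ge> 0" using ab by (simp add: w_def)
  show ?thesis
  proof (cases "b \<ge> 1")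
    case True
    have A: "(1 - t) * dual_transform a + t * dual_transform b - 1 / 2 * w * (13224/1000 + (247/100) * (156/100) ^ 2
        + (185/10) * ((156/100) ^ (2 + 2) / real (2 + 2) + (2595/1000) * ((156/100) ^ (2 + 1) / real (2 + 1)))) \<le> dual_transform ((1 - t) * a + t * b)"
      unfolding w_def using ab by (intro dual_transform_chord_bound) (auto intro!: mult_left_le)
    have "1 / 2 * w * (13224/1000 + (247/100) * (156/100) ^ 2
        + (185/10) * ((156/100) ^ (2 + 2) / real (2 + 2) + (2595/1000) * ((156/100) ^ (2 + 1) / real (2 + 1)))) \<le> 1 / 2 * w * 128"
      using w by (intro mult_left_mono) (auto simp: power_divide)
    also have "\<dots> = 64 * min 1 b * w" using True by simp
    finally show ?thesis
      unfolding w_def[symmetric] by (intro order_trans[OF diff_left_mono A])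
  next
    case False
    have A: "(1 - t) * dual_transform a + t * dual_transform b - b / 2 * w * (13224/1000 + (247/100) * (156/100) ^ 3
        + (185/10) * ((156/100) ^ (3 + 2) / real (3 + 2) + (2595/1000) * ((156/100) ^ (3 + 1) / real (3 + 1)))) \<le> dual_transform ((1 - t) * a + t * b)"
      unfolding w_def
    proof (rule dual_transform_chord_bound[OF ab])
      fix s x assume s: "(0::real) \<le> s" and x: "a \<le> x" "x \<le> b"
      have "\<bar>sin (x * s)\<bar> \<le> x * s"
        using s x ab abs_sin_x_le_abs_x[of "x * s"] by simp
      also have "\<dots> \<le> b * s" using s x by (intro mult_right_mono)
      finally have "s\<^sup>2 * \<bar>sin (x * s)\<bar> \<le> s\<^sup>2 * (b * s)" by (intro mult_left_mono) auto
      then show "s\<^sup>2 * \<bar>sin (x * s)\<bar> \<le> b * s ^ 3"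
        by (simp add: power2_eq_square power3_eq_cube mult_ac)
    qed (use ab in simp)
    have "b / 2 * w * (13224/1000 + (247/100) * (156/100) ^ 3
        + (185/10) * ((156/100) ^ (3 + 2) / real (3 + 2) + (2595/1000) * ((156/100) ^ (3 + 1) / real (3 + 1)))) \<le> b / 2 * w * 128"
      using w ab by (intro mult_left_mono) (auto simp: power_divide)
    also have "\<dots> = 64 * min 1 b * w" using False by simp
    finally show ?thesis
      unfolding w_def[symmetric] by (intro order_trans[OF diff_left_mono A])
  qed
qed

lemma quarter_bound: "t * (1 - t) \<le> (1 / 4 :: real)"
proof -
  have "0 \<le> (t - 1/2)\<^sup>2" by simp
  then show ?thesis by (simp add: power2_eq_square algebra_simps)
qed

lemma dual_transform_nonneg_between:
  assumes ab: "0 < a" "a < b" "a \<le> x" "x \<le> b"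
    and "16 * (b - a)\<^sup>2 * min 1 b \<le> dual_transform a" "16 * (b - a)\<^sup>2 * min 1 b \<le> dual_transform b"
  shows "0 \<le> dual_transform x"
proof -
  define t where "t = (x - a) / (b - a)"
  define c where "c = 16 * (b - a)\<^sup>2 * min 1 b"
  have t: "0 \<le> t" "t \<le> 1" using ab by (auto simp: t_def)
  have x: "x = (1 - t) * a + t * b"
  proof -
    have "t * (b - a) = x - a" using ab by (simp add: t_def)
    then show ?thesis by (simp add: algebra_simps)
  qed
  have "c = (1 - t) * c + t * c" by (simp add: algebra_simps)
  also have "\<dots> \<le> (1 - t) * dual_transform a + t * dual_transform b"
    using assms t by (intro add_mono mult_left_mono) (auto simp: c_def)
  finally have 1: "c \<le> (1 - t) * dual_transform a + t * dual_transform b" .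
  have "64 * min 1 b * (t * (1 - t) * (b - a)\<^sup>2) \<le> 64 * min 1 b * (1 / 4 * (b - a)\<^sup>2)"
    using ab by (intro mult_left_mono mult_right_mono quarter_bound) auto
  also have "\<dots> = c" by (simp add: c_def)
  finally have 2: "64 * min 1 b * (t * (1 - t) * (b - a)\<^sup>2) \<le> c" .
  show ?thesis
    using dual_transform_chord[of a b t] ab t 1 2 unfolding x by linarith
qed

text \<open>Up to \<open>12.5\<close> the transform has shallow minima, the lowest about \<open>0.016\<close>, so the grid has step \<open>1/40\<close>,
for which the interpolation error is at most \<open>1/100\<close>. From there to \<open>24\<close> the transform stays above \<open>2\<close>, and step
\<open>1/4\<close>, with error at most \<open>1\<close>, suffices. The requirement on the fine grid is scaled down near the origin in
proportion to the argument. The first interval is special because the transform vanishes at its left end: there the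
chord is compared with an error that is also proportional to the argument.\<close>

lemma dual_transform_nonneg_of_nodes:
  assumes fine: "\<And>i. 1 \<le> i \<Longrightarrow> i \<le> 500 \<Longrightarrow> min 1 (real i / 10) / 100 \<le> dual_transform (real i / 40)"
    and coarse: "\<And>i. 50 \<le> i \<Longrightarrow> i \<le> 96 \<Longrightarrow> 1 \<le> dual_transform (real i / 4)"
    and x: "x > 0"
  shows "0 \<le> dual_transform x"
proof -
  consider "x \<le> 1/40" | "1/40 < x" "x < 25/2" | "25/2 \<le> x" "x < 24" | "24 \<le> x" by linarith
  then show ?thesis
  proof cases
    case 1
    define t where "t = 40 * x"
    have t: "0 \<le> t" "t \<le> 1" using 1 x by (auto simp: t_def)
    have H0: "dual_transform 0 = 0" by (simp add: dual_transform_def)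
    have xt: "x = (1 - t) * 0 + t * (1/40)" by (simp add: t_def)
    have "(1 - t) * dual_transform 0 + t * dual_transform (1/40) - 64 * min 1 (1/40) * (t * (1 - t) * (1/40 - 0)\<^sup>2) \<le> dual_transform x"
      unfolding xt using t by (intro dual_transform_chord) auto
    moreover have "t * (1/1000) \<le> t * dual_transform (1/40)"
      using fine[of 1] t by (intro mult_left_mono) auto
    moreover have "t * (1 - t) \<le> t" using t by (simp add: mult_left_le)
    ultimately show ?thesis by (simp add: H0 power2_eq_square)
  next
    case 2
    define i where "i = nat \<lfloor>40 * x\<rfloor>"
    have i0: "0 \<le> \<lfloor>40 * x\<rfloor>" using x by simp
    have i: "real i \<le> 40 * x" "40 * x < real i + 1"
      using i0 by (auto simp: i_def of_nat_nat)
    have "1 \<le> i"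
    proof (rule ccontr)
      assume "\<not> 1 \<le> i"
      then have "i = 0" by simp
      then show False using i 2 by simp
    qed
    have "i + 1 \<le> 500"
    proof -
      have "real i < 500" using i 2 by linarith
      then show ?thesis by linarith
    qed
    have sq: "16 * (real (i + 1) / 40 - real i / 40)\<^sup>2 = 1 / 100"
      by (simp add: diff_divide_distrib[symmetric] power2_eq_square)
    show ?thesis
    proof (rule dual_transform_nonneg_between[of "real i / 40" "real (i + 1) / 40"])
      have "min 1 (real (i + 1) / 40) \<le> min 1 (real i / 10)"
        using \<open>1 \<le> i\<close> by (auto simp: min_def)
      moreover have "min 1 (real (i + 1) / 40) \<le> min 1 (real (i + 1) / 10)"
        by (auto simp: min_def)
      ultimately show "16 * (real (i + 1) / 40 - real i / 40)\<^sup>2 * min 1 (real (i + 1) / 40) \<le> dual_transform (real i / 40)"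
        "16 * (real (i + 1) / 40 - real i / 40)\<^sup>2 * min 1 (real (i + 1) / 40) \<le> dual_transform (real (i + 1) / 40)"
        unfolding sq using fine[of i] fine[of "i + 1"] \<open>1 \<le> i\<close> \<open>i + 1 \<le> 500\<close> by linarith+
    qed (use i \<open>1 \<le> i\<close> in auto)
  next
    case 3
    define i where "i = nat \<lfloor>4 * x\<rfloor>"
    have i0: "0 \<le> \<lfloor>4 * x\<rfloor>" using x by simp
    have i: "real i \<le> 4 * x" "4 * x < real i + 1"
      using i0 by (auto simp: i_def of_nat_nat)
    have i1: "50 \<le> i"
    proof -
      have "49 < real i" using i 3 by linarith
      then show ?thesis by linarith
    qed
    have i2: "i + 1 \<le> 96"
    proof -
      have "real i < 96" using i 3 by linarith
      then show ?thesis by linarith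
    qed
    have sq: "16 * (real (i + 1) / 4 - real i / 4)\<^sup>2 = 1"
      by (simp add: diff_divide_distrib[symmetric] power2_eq_square)
    show ?thesis
    proof (rule dual_transform_nonneg_between[of "real i / 4" "real (i + 1) / 4"])
      show "16 * (real (i + 1) / 4 - real i / 4)\<^sup>2 * min 1 (real (i + 1) / 4) \<le> dual_transform (real i / 4)"
        "16 * (real (i + 1) / 4 - real i / 4)\<^sup>2 * min 1 (real (i + 1) / 4) \<le> dual_transform (real (i + 1) / 4)"
        unfolding sq using coarse[of i] coarse[of "i + 1"] i1 i2 by linarith+
    qed (use i i1 in auto)
  next
    case 4
    then show ?thesis by (rule dual_transform_nonneg_large)
  qed
qed

section \<open>Node values in integer arithmetic\<close>

text \<open>A pair of integers \<open>(c, s)\<close> stands for the complex number \<open>(c + \<i> s) / 2\<^sup>4\<^sup>0\<close>; here two such numbers are multiplied, with the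
product rounded down to the same precision.\<close>

definition rot :: "int \<times> int \<Rightarrow> int \<times> int \<Rightarrow> int \<times> int" where
  "rot w z = (drop_bit 40 (fst z * fst w - snd z * snd w), drop_bit 40 (fst z * snd w + snd z * fst w))"

text \<open>Given \<open>s, u, v\<close> for the sine of \<open>x = j / 200\<close> and the sine and cosine of \<open>1.56 x\<close>, all scaled by \<open>2\<^sup>4\<^sup>0\<close>, this
says that the closed form of the transform at \<open>x\<close> is at least \<open>(d\<^sup>2 min 50 j + 25) / 125000\<close>. With
\<open>d / 200\<close> as the step, the first summand is what interpolation requires at \<open>x\<close>, and the second is the
allowance \<open>1/5000\<close> for the errors of the trigonometric values. All denominators have been cleared: \<open>A\<close> and \<open>A'\<close> are
\<open>40000 (x\<^sup>2 - 8.18\<^sup>2)\<close> and \<open>40000 (x\<^sup>2 - 13.105\<^sup>2)\<close>, whose product may be negative, and the four large literals in the second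
part are the cosines and sines of \<open>12.7608\<close> and \<open>20.4438\<close> scaled by \<open>2\<^sup>3\<^sup>0 = 1073741824\<close>.\<close>

definition node_ok :: "int \<Rightarrow> int \<Rightarrow> int \<Rightarrow> int \<Rightarrow> int \<Rightarrow> bool" where
  "node_ok d j s u v = (let A = j * j - 2676496; A' = j * j - 6869641; D = A * A';
     Z = 1073741824 * (j * j) * D * (625 * j * 1099511627776 + 1653000 * s + 308750 * u
           - 1099511627776 * (d * d * min 50 j + 25))
       - 2312500 * (1073741824 * D * (40000 * u - 312 * j * v)
           + j * j * (326 * (1636 * 1053510462 * u - j * 207454118 * v) * A'
                    + 193 * (2621 * (- 25174525) * u - j * 1073446667 * v) * A))
     in 0 < D \<and> 0 \<le> Z \<or> D < 0 \<and> Z \<le> 0)"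

text \<open>Visits the nodes \<open>j, j + d, j + 2 d, ...\<close> and checks those from \<open>lo\<close> on. The two running values are powers of the base
values \<open>w, w'\<close>, which represent the trigonometric values for one step of the arguments \<open>x\<close> and \<open>1.56 x\<close>.\<close>

fun scan :: "nat \<Rightarrow> int \<Rightarrow> int \<Rightarrow> int \<times> int \<Rightarrow> int \<times> int \<Rightarrow> int \<Rightarrow> int \<times> int \<Rightarrow> int \<times> int \<Rightarrow> bool" where
  "scan 0 d lo w w' j z z' = True"
| "scan (Suc n) d lo w w' j z z' =
    ((j < lo \<or> node_ok d j (snd z) (snd z') (fst z')) \<and> scan n d lo w w' (j + d) (rot w z) (rot w' z'))"

definition approx_cis :: "real \<Rightarrow> real \<Rightarrow> int \<times> int \<Rightarrow> bool" where
  "approx_cis \<epsilon> \<theta> z \<longleftrightarrow>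
     cmod (Complex (of_int (fst z) / 2 ^ 40) (of_int (snd z) / 2 ^ 40) - cis \<theta>) \<le> \<epsilon>"

lemma approx_cisD:
  assumes "approx_cis \<epsilon> \<theta> z"
  shows "\<bar>cos \<theta> - of_int (fst z) / 2 ^ 40\<bar> \<le> \<epsilon>" "\<bar>sin \<theta> - of_int (snd z) / 2 ^ 40\<bar> \<le> \<epsilon>"
  using assms order_trans[OF abs_Re_le_cmod, of _ \<epsilon>] order_trans[OF abs_Im_le_cmod, of _ \<epsilon>]
  unfolding approx_cis_def by (force simp: abs_minus_commute)+

lemma approx_cisI:
  assumes "\<bar>cos \<theta> - of_int (fst z) / 2 ^ 40\<bar> \<le> \<epsilon>" "\<bar>sin \<theta> - of_int (snd z) / 2 ^ 40\<bar> \<le> \<epsilon>"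
  shows "approx_cis (2 * \<epsilon>) \<theta> z"
  unfolding approx_cis_def
  using assms order_trans[OF cmod_le[of "Complex (of_int (fst z) / 2 ^ 40) (of_int (snd z) / 2 ^ 40) - cis \<theta>"]]
  by (simp add: abs_minus_commute)

lemma drop_bit_approx: "\<bar>of_int a - (of_int (drop_bit 40 a) :: real) * 2 ^ 40\<bar> \<le> 2 ^ 40"
proof -
  have "a = drop_bit 40 a * 2 ^ 40 + take_bit 40 a"
    by (metis bits_ident push_bit_eq_mult)
  moreover have "0 \<le> take_bit 40 a" "take_bit 40 a < 2 ^ 40"
    by (simp_all del: power_numeral)
  ultimately have "\<bar>a - drop_bit 40 a * 2 ^ 40\<bar> \<le> 2 ^ 40" by linarith
  then have "real_of_int \<bar>a - drop_bit 40 a * 2 ^ 40\<bar> \<le> real_of_int (2 ^ 40)"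
    by (simp only: of_int_le_iff)
  then show ?thesis by simp
qed

lemma approx_cis_mono: "approx_cis \<epsilon> \<theta> z \<Longrightarrow> \<epsilon> \<le> \<epsilon>' \<Longrightarrow> approx_cis \<epsilon>' \<theta> z"
  unfolding approx_cis_def by (rule order_trans)

text \<open>Errors add up because multiplication by a number of modulus one is an isometry; rounding contributes at most one unit in
each component.\<close>

lemma approx_cis_rot:
  assumes z: "approx_cis \<epsilon> \<theta> z" and w: "approx_cis \<delta> \<phi> w"
  shows "approx_cis (\<epsilon> + (1 + \<epsilon>) * \<delta> + 2 / 2 ^ 40) (\<theta> + \<phi>) (rot w z)"
proof -
  let ?C = "\<lambda>z. Complex (of_int (fst z) / 2 ^ 40) (of_int (snd z) / 2 ^ 40)"
  have scale: "\<bar>of_int (drop_bit 40 a) / 2 ^ 40 - of_int a / (2 ^ 40 * 2 ^ 40)\<bar> \<le> (1 / 2 ^ 40 :: real)" for a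
  proof -
    define M where "M = (2 ^ 40 :: real)"
    have M: "M > 0" by (simp add: M_def)
    have "of_int (drop_bit 40 a) / M - of_int a / (M * M) = - (of_int a - of_int (drop_bit 40 a) * M) / (M * M)"
      using M by (simp add: field_simps)
    moreover have "\<bar>- (of_int a - of_int (drop_bit 40 a) * M) / (M * M)\<bar> \<le> M / (M * M)"
      unfolding abs_divide abs_minus_cancel using drop_bit_approx[of a] M
      by (simp only: M_def abs_mult abs_of_pos) (rule divide_right_mono, auto)
    ultimately show ?thesis using M unfolding M_def[symmetric] by simp
  qed
  have "cmod (?C (rot w z) - ?C z * ?C w) \<le> 1 / 2 ^ 40 + 1 / 2 ^ 40"
  proof (rule order_trans[OF cmod_le add_mono])
    show "\<bar>Re (?C (rot w z) - ?C z * ?C w)\<bar> \<le> 1 / 2 ^ 40"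
      using scale[of "fst z * fst w - snd z * snd w"] by (simp add: rot_def diff_divide_distrib)
    show "\<bar>Im (?C (rot w z) - ?C z * ?C w)\<bar> \<le> 1 / 2 ^ 40"
      using scale[of "fst z * snd w + snd z * fst w"] by (simp add: rot_def add_divide_distrib)
  qed
  moreover have "cmod (?C z * (?C w - cis \<phi>)) \<le> (1 + \<epsilon>) * \<delta>"
  proof -
    have "cmod (?C z) \<le> cmod (cis \<theta>) + cmod (?C z - cis \<theta>)"
      using norm_triangle_ineq[of "cis \<theta>" "?C z - cis \<theta>"] by simp
    also have "\<dots> \<le> 1 + \<epsilon>" using z by (simp add: approx_cis_def)
    finally show ?thesis
      using w unfolding norm_mult approx_cis_def by (intro mult_mono) (auto intro: order_trans[OF norm_ge_zero])
  qed
  moreover have "cmod ((?C z - cis \<theta>) * cis \<phi>) \<le> \<epsilon>"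
    using z by (simp add: norm_mult approx_cis_def)
  moreover have "?C (rot w z) - cis (\<theta> + \<phi>)
      = (?C (rot w z) - ?C z * ?C w) + (?C z * (?C w - cis \<phi>) + (?C z - cis \<theta>) * cis \<phi>)"
    by (simp add: algebra_simps cis_mult)
  moreover have "cmod (?C (rot w z) - cis (\<theta> + \<phi>))
      \<le> cmod (?C (rot w z) - ?C z * ?C w) + (cmod (?C z * (?C w - cis \<phi>)) + cmod ((?C z - cis \<theta>) * cis \<phi>))"
    unfolding calculation(4) by (intro order_trans[OF norm_triangle_ineq] add_left_mono norm_triangle_ineq)
  ultimately show ?thesis unfolding approx_cis_def by simp
qed

text \<open>Each multiplication adds at most five units of \<open>2\<^sup>-\<^sup>4\<^sup>0\<close> to the error: two for the rounding and at most three for the error of the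
base value. After 500 steps the error is still below \<open>3 / 10\<^sup>9\<close>.\<close>

lemma scan_sound:
  assumes "scan n d lo w w' (d * int k) z z'" and "k + n \<le> 501"
    and "approx_cis (2 / 2 ^ 40) \<theta> w" "approx_cis (2 / 2 ^ 40) \<phi> w'"
    and "approx_cis (5 * real k / 2 ^ 40) (real k * \<theta>) z" "approx_cis (5 * real k / 2 ^ 40) (real k * \<phi>) z'"
    and "k \<le> i" "i < k + n" "lo \<le> d * int i"
  shows "\<exists>s u v. node_ok d (d * int i) s u v \<and> \<bar>sin (real i * \<theta>) - of_int s / 2 ^ 40\<bar> \<le> 3 / 10 ^ 9
    \<and> \<bar>sin (real i * \<phi>) - of_int u / 2 ^ 40\<bar> \<le> 3 / 10 ^ 9 \<and> \<bar>cos (real i * \<phi>) - of_int v / 2 ^ 40\<bar> \<le> 3 / 10 ^ 9"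
  using assms
proof (induction n arbitrary: k z z')
  case 0
  then show ?case by simp
next
  case (Suc n)
  have small: "5 * real k / 2 ^ 40 \<le> 3 / 10 ^ 9"
    using Suc.prems(2) by (simp add: divide_le_eq)
  show ?case
  proof (cases "i = k")
    case True
    then have "node_ok d (d * int i) (snd z) (snd z') (fst z')"
      using Suc.prems(1,9) by auto
    moreover have "\<bar>sin (real i * \<theta>) - of_int (snd z) / 2 ^ 40\<bar> \<le> 3 / 10 ^ 9"
      "\<bar>sin (real i * \<phi>) - of_int (snd z') / 2 ^ 40\<bar> \<le> 3 / 10 ^ 9"
      "\<bar>cos (real i * \<phi>) - of_int (fst z') / 2 ^ 40\<bar> \<le> 3 / 10 ^ 9"
      using approx_cisD[OF Suc.prems(5)] approx_cisD[OF Suc.prems(6)] small True by (auto intro: order_trans)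
    ultimately show ?thesis by blast
  next
    case False
    have step: "approx_cis (5 * real (Suc k) / 2 ^ 40) (real (Suc k) * \<alpha>) (rot y x)"
      if "approx_cis (5 * real k / 2 ^ 40) (real k * \<alpha>) x" "approx_cis (2 / 2 ^ 40) \<alpha> y" for \<alpha> x y
    proof -
      have "real k * \<alpha> + \<alpha> = real (Suc k) * \<alpha>" by (simp add: algebra_simps)
      moreover have "5 * real k / 2 ^ 40 + (1 + 5 * real k / 2 ^ 40) * (2 / 2 ^ 40) + 2 / 2 ^ 40
          \<le> 5 * real (Suc k) / 2 ^ 40"
      proof -
        have "(1 + 5 * real k / 2 ^ 40) * (2 / 2 ^ 40) \<le> (1 + 1 / 2) * (2 / 2 ^ 40)"
          using Suc.prems(2) by (intro mult_right_mono add_left_mono) (auto simp: divide_le_eq)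
        then show ?thesis by (simp add: add_divide_distrib)
      qed
      ultimately show ?thesis
        using approx_cis_mono[OF approx_cis_rot[OF that]] by simp
    qed
    show ?thesis
    proof (rule Suc.IH)
      show "scan n d lo w w' (d * int (Suc k)) (rot w z) (rot w' z')"
        using Suc.prems(1) by (simp add: algebra_simps)
      show "approx_cis (5 * real (Suc k) / 2 ^ 40) (real (Suc k) * \<theta>) (rot w z)"
        "approx_cis (5 * real (Suc k) / 2 ^ 40) (real (Suc k) * \<phi>) (rot w' z')"
        using step Suc.prems(3-6) by blast+
    qed (use Suc.prems False in auto)
  qed
qed

lemma sum_lessThan_12: "(\<Sum>m<12. f m) = f 0 + f 1 + f 2 + f 3 + f 4 + f 5 + f 6 + f 7 + f 8 + f 9 + f 10 + f (11 :: nat)"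
  for f :: "nat \<Rightarrow> real"
  by (simp add: eval_nat_numeral)

lemma trig_taylor:
  fixes x :: real
  shows "\<bar>sin x - (x - x ^ 3 / 6 + x ^ 5 / 120 - x ^ 7 / 5040 + x ^ 9 / 362880 - x ^ 11 / 39916800)\<bar>
      \<le> \<bar>x\<bar> ^ 12 / 479001600"
    and "\<bar>cos x - (1 - x ^ 2 / 2 + x ^ 4 / 24 - x ^ 6 / 720 + x ^ 8 / 40320 - x ^ 10 / 3628800)\<bar>
      \<le> \<bar>x\<bar> ^ 12 / 479001600"
proof -
  have fact12: "fact 12 = (479001600 :: real)" by (simp add: fact_numeral)
  have "(\<Sum>m<12. sin_coeff m * x ^ m) = x - x ^ 3 / 6 + x ^ 5 / 120 - x ^ 7 / 5040 + x ^ 9 / 362880 - x ^ 11 / 39916800"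
    unfolding sum_lessThan_12 by (simp add: sin_coeff_def fact_numeral)
  then show "\<bar>sin x - (x - x ^ 3 / 6 + x ^ 5 / 120 - x ^ 7 / 5040 + x ^ 9 / 362880 - x ^ 11 / 39916800)\<bar>
      \<le> \<bar>x\<bar> ^ 12 / 479001600"
    using Maclaurin_sin_bound[of x 12] by (simp add: fact12)
  obtain t where t: "cos x = (\<Sum>m<12. cos_coeff m * x ^ m) + (cos (t + 1/2 * real 12 * pi) / fact 12) * x ^ 12"
    using Maclaurin_cos_expansion by blast
  have "\<bar>cos (t + 1/2 * real 12 * pi) / fact 12 * x ^ 12\<bar> = \<bar>cos (t + 1/2 * real 12 * pi)\<bar> * (\<bar>x\<bar> ^ 12 / 479001600)"
    by (simp add: fact12 abs_mult power_abs)
  also have "\<dots> \<le> 1 * (\<bar>x\<bar> ^ 12 / 479001600)"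
    by (intro mult_right_mono) auto
  finally have "\<bar>cos (t + 1/2 * real 12 * pi) / fact 12 * x ^ 12\<bar> \<le> \<bar>x\<bar> ^ 12 / 479001600" by simp
  moreover have "(\<Sum>m<12. cos_coeff m * x ^ m) = 1 - x ^ 2 / 2 + x ^ 4 / 24 - x ^ 6 / 720 + x ^ 8 / 40320 - x ^ 10 / 3628800"
    unfolding sum_lessThan_12 by (simp add: cos_coeff_def fact_numeral)
  ultimately show "\<bar>cos x - (1 - x ^ 2 / 2 + x ^ 4 / 24 - x ^ 6 / 720 + x ^ 8 / 40320 - x ^ 10 / 3628800)\<bar>
      \<le> \<bar>x\<bar> ^ 12 / 479001600"
    using t by simp
qed

lemma approx_cis_base:
  "approx_cis (2 / 2 ^ 40) (1/40) (1099168048288, 27484927472)"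
  "approx_cis (2 / 2 ^ 40) (39/1000) (1098675555163, 42870083988)"
  "approx_cis (2 / 2 ^ 40) (1/4) (1065330473967, 272023529958)"
  "approx_cis (2 / 2 ^ 40) (39/100) (1016948265948, 418021583174)"
proof -
  have *: "approx_cis (2 / 2 ^ 40) \<theta> (c, s)"
    if "\<bar>(1 - \<theta> ^ 2 / 2 + \<theta> ^ 4 / 24 - \<theta> ^ 6 / 720 + \<theta> ^ 8 / 40320 - \<theta> ^ 10 / 3628800) - of_int c / 2 ^ 40\<bar> \<le> 3 / 4 / 2 ^ 40"
      "\<bar>(\<theta> - \<theta> ^ 3 / 6 + \<theta> ^ 5 / 120 - \<theta> ^ 7 / 5040 + \<theta> ^ 9 / 362880 - \<theta> ^ 11 / 39916800) - of_int s / 2 ^ 40\<bar> \<le> 3 / 4 / 2 ^ 40"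
      "\<bar>\<theta>\<bar> ^ 12 / 479001600 \<le> 1 / 4 / 2 ^ 40" for \<theta> :: real and c s
  proof -
    have "\<bar>cos \<theta> - of_int c / 2 ^ 40\<bar> \<le> 1 / 2 ^ 40" "\<bar>sin \<theta> - of_int s / 2 ^ 40\<bar> \<le> 1 / 2 ^ 40"
      using trig_taylor[of \<theta>] that by linarith+
    then show ?thesis using approx_cisI[of \<theta> "(c, s)" "1 / 2 ^ 40"] by simp
  qed
  show "approx_cis (2 / 2 ^ 40) (1/40) (1099168048288, 27484927472)"
    by (rule *) (simp_all add: power_divide)
  show "approx_cis (2 / 2 ^ 40) (39/1000) (1098675555163, 42870083988)"
    by (rule *) (simp_all add: power_divide)
  show "approx_cis (2 / 2 ^ 40) (1/4) (1065330473967, 272023529958)"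
    by (rule *) (simp_all add: power_divide)
  show "approx_cis (2 / 2 ^ 40) (39/100) (1016948265948, 418021583174)"
    by (rule *) (simp_all add: power_divide)
qed

lemma trig_lipschitz:
  fixes x y :: real
  shows "\<bar>sin x - sin y\<bar> \<le> \<bar>x - y\<bar>" "\<bar>cos x - cos y\<bar> \<le> \<bar>x - y\<bar>"
proof -
  have half: "\<bar>2 * (sin ((x - y) / 2) * b)\<bar> \<le> \<bar>x - y\<bar>" if "\<bar>b\<bar> \<le> 1" for b
  proof -
    have "\<bar>sin ((x - y) / 2)\<bar> * \<bar>b\<bar> \<le> \<bar>(x - y) / 2\<bar> * 1"
      using that by (intro mult_mono abs_sin_x_le_abs_x) auto
    then show ?thesis by (simp add: abs_mult)
  qed
  show "\<bar>sin x - sin y\<bar> \<le> \<bar>x - y\<bar>"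
    using half[of "cos ((x + y) / 2)"] by (simp add: sin_diff_sin mult.assoc)
  have "\<bar>cos y - cos x\<bar> \<le> \<bar>x - y\<bar>"
    using half[of "sin ((x + y) / 2)"] cos_diff_cos[of y x]
    by (simp add: mult_ac add.commute)
  then show "\<bar>cos x - cos y\<bar> \<le> \<bar>x - y\<bar>" by (simp add: abs_minus_commute)
qed

text \<open>The two arguments are \<open>4 \<pi> + 0.19443\<close> and \<open>13 \<pi> / 2 + 0.02345\<close> up to rounding, which leaves small arguments for the Taylor polynomials.\<close>

lemma edge_values:
  "\<bar>cos (127608/10000 :: real) - 1053510462 / 2 ^ 30\<bar> \<le> 3 / 10 ^ 9"
  "\<bar>sin (127608/10000 :: real) - 207454118 / 2 ^ 30\<bar> \<le> 3 / 10 ^ 9"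
  "\<bar>cos (204438/10000 :: real) - - (25174525 / 2 ^ 30)\<bar> \<le> 3 / 10 ^ 9"
  "\<bar>sin (204438/10000 :: real) - 1073446667 / 2 ^ 30\<bar> \<le> 3 / 10 ^ 9"
proof -
  have pi: "3141592653588 / 10 ^ 12 \<le> pi" "pi \<le> 31415926535899 / 10 ^ 13"
    using pi_approx by simp_all
  \<comment> \<open>Fractions with small denominators, within \<open>3 / 10\<^sup>1\<^sup>0\<close> of the remainders after subtracting multiples of \<open>\<pi>\<close>.\<close>
  define a where "a = (13270 / 68251 :: real)"
  define b where "b = (679 / 28958 :: real)"
  have a: "\<bar>(127608/10000 - 4 * pi) - a\<bar> \<le> 3 / 10 ^ 10"
    using pi unfolding a_def abs_le_iff by (simp add: field_simps)
  have b: "\<bar>(204438/10000 - 13/2 * pi) - b\<bar> \<le> 3 / 10 ^ 10"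
    using pi unfolding b_def abs_le_iff by (simp add: field_simps)
  have "cos (127608/10000 :: real) = cos ((127608/10000 - 4 * pi) + 2 * real 2 * pi)" by simp
  also have "\<dots> = cos (127608/10000 - 4 * pi)"
    unfolding cos_add cos_2npi sin_2npi by simp
  finally have ca: "\<bar>cos (127608/10000 :: real) - cos a\<bar> \<le> 3 / 10 ^ 10"
    using trig_lipschitz(2)[of "127608/10000 - 4 * pi" a] a by simp
  have "sin (127608/10000 :: real) = sin ((127608/10000 - 4 * pi) + 2 * real 2 * pi)" by simp
  also have "\<dots> = sin (127608/10000 - 4 * pi)"
    unfolding sin_add cos_2npi sin_2npi by simp
  finally have sa: "\<bar>sin (127608/10000 :: real) - sin a\<bar> \<le> 3 / 10 ^ 10"
    using trig_lipschitz(1)[of "127608/10000 - 4 * pi" a] a by simp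
  have shift: "cos (d + pi / 2 + 2 * real 3 * pi) = - sin d" "sin (d + pi / 2 + 2 * real 3 * pi) = cos d" for d
    unfolding cos_add[of _ "2 * real 3 * pi"] sin_add[of _ "2 * real 3 * pi"] cos_2npi sin_2npi
    by (simp_all add: cos_add sin_add)
  have eq: "204438/10000 = (204438/10000 - 13/2 * pi) + pi / 2 + 2 * real 3 * pi" by simp
  have cb: "\<bar>cos (204438/10000 :: real) + sin b\<bar> \<le> 3 / 10 ^ 10"
    using trig_lipschitz(1)[of "204438/10000 - 13/2 * pi" b] b
    by (subst eq, subst shift(1)) linarith
  have sb: "\<bar>sin (204438/10000 :: real) - cos b\<bar> \<le> 3 / 10 ^ 10"
    using trig_lipschitz(2)[of "204438/10000 - 13/2 * pi" b] b
    by (subst eq, subst shift(2)) linarith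
  have small: "\<bar>a\<bar> ^ 12 / 479001600 \<le> 1 / 10 ^ 10" "\<bar>b\<bar> ^ 12 / 479001600 \<le> 1 / 10 ^ 10"
    by (simp_all add: a_def b_def power_divide)
  have tri: "\<bar>X - R\<bar> \<le> 3 / 10 ^ 9"
    if "\<bar>X - Y\<bar> \<le> 3 / 10 ^ 10" "\<bar>Y - P\<bar> \<le> t" "t \<le> 1 / 10 ^ 10" "\<bar>P - R\<bar> \<le> 2 / 10 ^ 9" for X Y P R t :: real
  proof -
    have "\<bar>X - R\<bar> \<le> 3 / 10 ^ 10 + (1 / 10 ^ 10 + 2 / 10 ^ 9)"
      using that by linarith
    also have "\<dots> \<le> 3 / 10 ^ 9" by simp
    finally show ?thesis .
  qed
  show "\<bar>cos (127608/10000 :: real) - 1053510462 / 2 ^ 30\<bar> \<le> 3 / 10 ^ 9"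
    by (rule tri[OF ca trig_taylor(2) small(1)]) (simp add: a_def power_divide)
  show "\<bar>sin (127608/10000 :: real) - 207454118 / 2 ^ 30\<bar> \<le> 3 / 10 ^ 9"
    by (rule tri[OF sa trig_taylor(1) small(1)]) (simp add: a_def power_divide)
  have "\<bar>- cos (204438/10000 :: real) - sin b\<bar> \<le> 3 / 10 ^ 10" using cb by linarith
  then have "\<bar>- cos (204438/10000 :: real) - 25174525 / 2 ^ 30\<bar> \<le> 3 / 10 ^ 9"
    by (rule tri[OF _ trig_taylor(1) small(2)]) (simp add: b_def power_divide)
  then show "\<bar>cos (204438/10000 :: real) - - (25174525 / 2 ^ 30)\<bar> \<le> 3 / 10 ^ 9" by linarith
  show "\<bar>sin (204438/10000 :: real) - 1073446667 / 2 ^ 30\<bar> \<le> 3 / 10 ^ 9"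
    by (rule tri[OF sb trig_taylor(2) small(2)]) (simp add: b_def power_divide)
qed

text \<open>The closed form has removable singularities at \<open>0\<close>, \<open>8.18\<close> and \<open>13.105\<close>, which magnify errors in the trigonometric
values. The nodes \<open>j / 200\<close> with \<open>5\<close> dividing \<open>j\<close> stay at distance \<open>1/40\<close> from the first and \<open>1/200\<close> from the other two, so the
factor is about \<open>5 * 10\<^sup>4\<close>.\<close>

lemma dual_transform_closed_perturbation:
  fixes c1 s1 c2 s2 s u v c1' s1' c2' s2' s' u' v' x :: real
  defines "\<tau> \<equiv> 3 / 10 ^ 9"
  assumes x: "1 / 40 \<le> x" "1 / 200 \<le> \<bar>x - 818/100\<bar>" "1 / 200 \<le> \<bar>x - 13105/1000\<bar>"
    and one: "\<bar>c1\<bar> \<le> 1" "\<bar>s1\<bar> \<le> 1" "\<bar>c2\<bar> \<le> 1" "\<bar>s2\<bar> \<le> 1" "\<bar>u\<bar> \<le> 1" "\<bar>v\<bar> \<le> 1"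
    and c: "\<bar>c1 - c1'\<bar> \<le> \<tau>" "\<bar>s1 - s1'\<bar> \<le> \<tau>" "\<bar>c2 - c2'\<bar> \<le> \<tau>" "\<bar>s2 - s2'\<bar> \<le> \<tau>"
    and suv: "\<bar>s - s'\<bar> \<le> \<tau>" "\<bar>u - u'\<bar> \<le> \<tau>" "\<bar>v - v'\<bar> \<le> \<tau>"
  shows "dual_transform_closed c1' s1' c2' s2' x s' u' v' - 1 / 5000 \<le> dual_transform_closed c1 s1 c2 s2 x s u v"
proof -
  have \<tau>: "0 \<le> \<tau>" "\<tau> \<le> 1 / 10" by (simp_all add: \<tau>_def)
  have prod: "\<bar>a * b - a' * b'\<bar> \<le> 21/10 * \<tau>"
    if "\<bar>a\<bar> \<le> 1" "\<bar>b\<bar> \<le> 1" "\<bar>a - a'\<bar> \<le> \<tau>" "\<bar>b - b'\<bar> \<le> \<tau>" for a b a' b' :: real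
  proof -
    have "\<bar>b'\<bar> \<le> 11/10" using that \<tau> by linarith
    have "a * b - a' * b' = a * (b - b') + (a - a') * b'" by (simp add: algebra_simps)
    also have "\<bar>\<dots>\<bar> \<le> \<bar>a\<bar> * \<bar>b - b'\<bar> + \<bar>a - a'\<bar> * \<bar>b'\<bar>"
      by (metis abs_mult abs_triangle_ineq)
    also have "\<dots> \<le> 1 * \<tau> + \<tau> * (11/10)"
      using that \<tau> \<open>\<bar>b'\<bar> \<le> 11/10\<close> by (intro add_mono mult_mono) auto
    finally show ?thesis by simp
  qed
  define R1 where "R1 = ((u - u') - (156/100) * x * (v - v')) / x\<^sup>2"
  define R2 where "R2 = ((818/100) * (c1 * u - c1' * u') - x * (s1 * v - s1' * v')) / (x\<^sup>2 - (818/100)\<^sup>2)"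
  define R3 where "R3 = ((13105/1000) * (c2 * u - c2' * u') - x * (s2 * v - s2' * v')) / (x\<^sup>2 - (13105/1000)\<^sup>2)"
  have diff: "dual_transform_closed c1 s1 c2 s2 x s u v - dual_transform_closed c1' s1' c2' s2' x s' u' v'
      = (13224/1000) * (s - s') + (247/100) * (u - u') - (185/10) * (R1 + (163/100) * R2 + (965/1000) * R3)"
  proof -
    have 1: "R1 = (u - (156/100) * x * v) / x\<^sup>2 - (u' - (156/100) * x * v') / x\<^sup>2"
      unfolding R1_def diff_divide_distrib[symmetric] by (simp add: right_diff_distrib mult.assoc)
    have 2: "R2 = ((818/100) * c1 * u - x * s1 * v) / (x\<^sup>2 - (818/100)\<^sup>2) - ((818/100) * c1' * u' - x * s1' * v') / (x\<^sup>2 - (818/100)\<^sup>2)"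
      unfolding R2_def diff_divide_distrib[symmetric] by (simp add: right_diff_distrib mult.assoc)
    have 3: "R3 = ((13105/1000) * c2 * u - x * s2 * v) / (x\<^sup>2 - (13105/1000)\<^sup>2) - ((13105/1000) * c2' * u' - x * s2' * v') / (x\<^sup>2 - (13105/1000)\<^sup>2)"
      unfolding R3_def diff_divide_distrib[symmetric] by (simp add: right_diff_distrib mult.assoc)
    have "(x + a * s + b * u - c * (p + k * g + l * w)) - (x + a * s' + b * u' - c * (p' + k * g' + l * w'))
        = a * (s - s') + b * (u - u') - c * ((p - p') + k * (g - g') + l * (w - w'))"
      for a b c p g w p' g' w' k l :: real
      by (simp add: algebra_simps)
    then show ?thesis unfolding 1 2 3 dual_transform_closed_def .
  qed
  have x0: "x > 0" using x by linarith
  have "\<bar>R1\<bar> \<le> \<tau> / x\<^sup>2 + (156/100) * \<tau> / x"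
  proof -
    have "R1 = (u - u') / x\<^sup>2 - (156/100) * ((v - v') / x)"
    proof -
      have "(p - l * x * w) / x\<^sup>2 = p / x\<^sup>2 - l * (w / x)" for p l w :: real
        using x0 by (simp add: field_simps power2_eq_square)
      then show ?thesis by (simp only: R1_def)
    qed
    also have "\<bar>\<dots>\<bar> \<le> \<bar>(u - u') / x\<^sup>2\<bar> + \<bar>(156/100) * ((v - v') / x)\<bar>" by (rule abs_triangle_ineq4)
    also have "\<dots> \<le> \<tau> / x\<^sup>2 + (156/100) * (\<tau> / x)"
      using suv x0 by (intro add_mono) (auto simp: abs_divide abs_mult intro!: divide_right_mono)
    finally show ?thesis by simp
  qed
  also have "\<dots> \<le> \<tau> * 1600 + (156/100) * \<tau> * 40"
  proof (rule add_mono)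
    have i: "1 / x \<le> 40" using x x0 by (simp add: divide_le_eq)
    have "(1 / x) * (1 / x) \<le> 40 * 40" using i x0 by (intro mult_mono) auto
    then have "\<tau> * ((1 / x) * (1 / x)) \<le> \<tau> * (40 * 40)" using \<tau> by (intro mult_left_mono)
    then show "\<tau> / x\<^sup>2 \<le> \<tau> * 1600" by (simp add: power2_eq_square)
    have "(156/100) * \<tau> * (1 / x) \<le> (156/100) * \<tau> * 40" using i \<tau> by (intro mult_left_mono) auto
    then show "(156/100) * \<tau> / x \<le> (156/100) * \<tau> * 40" by simp
  qed
  finally have R1: "\<bar>R1\<bar> \<le> \<tau> * 1600 + (156/100) * \<tau> * 40" .
  have R2: "\<bar>R2\<bar> \<le> 21/10 * \<tau> / (1 / 200)"
    unfolding R2_def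
    by (rule quotient_bound[OF _ x0 prod[OF one(1) one(5) c(1) suv(2)] prod[OF one(2) one(6) c(2) suv(3)] _ x(2)]) simp_all
  have R3: "\<bar>R3\<bar> \<le> 21/10 * \<tau> / (1 / 200)"
    unfolding R3_def
    by (rule quotient_bound[OF _ x0 prod[OF one(3) one(5) c(3) suv(2)] prod[OF one(4) one(6) c(4) suv(3)] _ x(3)]) simp_all
  have "- (1 / 5000) \<le> (13224/1000) * (s - s') + (247/100) * (u - u') - (185/10) * (R1 + (163/100) * R2 + (965/1000) * R3)"
  proof -
    have "185/10 * (R1 + (163/100) * R2 + (965/1000) * R3)
        \<le> 185/10 * ((\<tau> * 1600 + (156/100) * \<tau> * 40) + (163/100) * (420 * \<tau>) + (965/1000) * (420 * \<tau>))"
      using R1 R2 R3 by (intro mult_left_mono add_mono) auto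
    moreover have "- ((13224/1000) * \<tau>) \<le> (13224/1000) * (s - s')" "- ((247/100) * \<tau>) \<le> (247/100) * (u - u')"
      using suv by auto
    moreover have "(13224/1000) * \<tau> + (247/100) * \<tau>
        + 185/10 * ((\<tau> * 1600 + (156/100) * \<tau> * 40) + (163/100) * (420 * \<tau>) + (965/1000) * (420 * \<tau>)) \<le> 1 / 5000"
      by (simp add: \<tau>_def)
    ultimately show ?thesis by linarith
  qed
  then show ?thesis using diff by linarith
qed

lemma node_ok_sound:
  fixes d j s u v :: int
  assumes ok: "node_ok d j s u v" and "j > 0"
  shows "real_of_int (d * d * min 50 j + 25) / 125000
    \<le> dual_transform_closed (1053510462 / 2 ^ 30) (207454118 / 2 ^ 30) (- (25174525 / 2 ^ 30)) (1073446667 / 2 ^ 30)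
        (of_int j / 200) (of_int s / 2 ^ 40) (of_int u / 2 ^ 40) (of_int v / 2 ^ 40)"
proof -
  define J S U V m A A' where "J = real_of_int j" and "S = real_of_int s" and "U = real_of_int u" and "V = real_of_int v"
    and "m = real_of_int (d * d * min 50 j + 25)" and "A = J * J - 2676496" and "A' = J * J - 6869641"
  define Z where "Z = 1073741824 * (J * J) * (A * A') * (625 * J * 1099511627776 + 1653000 * S + 308750 * U
           - 1099511627776 * m)
       - 2312500 * (1073741824 * (A * A') * (40000 * U - 312 * J * V)
           + J * J * (326 * (1636 * 1053510462 * U - J * 207454118 * V) * A'
                    + 193 * (2621 * (- 25174525) * U - J * 1073446667 * V) * A))"
  have J: "J > 0" using \<open>j > 0\<close> by (simp add: J_def)
  have sign: "0 < A * A' \<and> 0 \<le> Z \<or> A * A' < 0 \<and> Z \<le> 0"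
  proof -
    define Ai A'i where "Ai = j * j - 2676496" and "A'i = j * j - 6869641"
    define Zi where "Zi = 1073741824 * (j * j) * (Ai * A'i) * (625 * j * 1099511627776 + 1653000 * s + 308750 * u
           - 1099511627776 * (d * d * min 50 j + 25))
       - 2312500 * (1073741824 * (Ai * A'i) * (40000 * u - 312 * j * v)
           + j * j * (326 * (1636 * 1053510462 * u - j * 207454118 * v) * A'i
                    + 193 * (2621 * (- 25174525) * u - j * 1073446667 * v) * Ai))"
    have D: "A * A' = real_of_int (Ai * A'i)" by (simp add: A_def A'_def Ai_def A'i_def J_def)
    have Z: "Z = real_of_int Zi"
      by (simp add: Z_def Zi_def A_def A'_def Ai_def A'i_def J_def S_def U_def V_def m_def)
    have "0 < Ai * A'i \<and> 0 \<le> Zi \<or> Ai * A'i < 0 \<and> Zi \<le> 0"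
      using ok unfolding node_ok_def Let_def Zi_def Ai_def A'i_def .
    then show ?thesis unfolding D Z by (simp only: of_int_0_less_iff of_int_0_le_iff of_int_less_0_iff of_int_le_0_iff)
  qed
  have ne: "A \<noteq> 0" "A' \<noteq> 0" using sign by auto
  define X where "X = dual_transform_closed (1053510462 / 2 ^ 30) (207454118 / 2 ^ 30) (- (25174525 / 2 ^ 30)) (1073446667 / 2 ^ 30)
        (J / 200) (S / 2 ^ 40) (U / 2 ^ 40) (V / 2 ^ 40)"
  have q1: "(J / 200)\<^sup>2 = J * J / 40000" by (simp add: power2_eq_square)
  have q2: "(J / 200)\<^sup>2 - (818/100)\<^sup>2 = A / 40000" "(J / 200)\<^sup>2 - (13105/1000)\<^sup>2 = A' / 40000"
    by (simp_all add: A_def A'_def power2_eq_square field_simps)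
  define Q B where "Q = (1073741824 :: real)" and "B = (1099511627776 :: real)"
  have pow: "(2 :: real) ^ 30 = Q" "(2 :: real) ^ 40 = B" by (simp_all add: Q_def B_def)
  have QB: "Q > 0" "B > 0" by (simp_all add: Q_def B_def)
  have X: "X = J / 200 + 13224/1000 * (S / B) + 247/100 * (U / B)
      - 185/10 * ((U / B - 156/100 * (J / 200) * (V / B)) / (J * J / 40000)
        + 163/100 * ((818/100 * (1053510462 / Q) * (U / B) - J / 200 * (207454118 / Q) * (V / B)) / (A / 40000))
        + 965/1000 * ((13105/1000 * (- (25174525 / Q)) * (U / B) - J / 200 * (1073446667 / Q) * (V / B)) / (A' / 40000)))"
    unfolding X_def dual_transform_closed_def q2 pow unfolding q1 by (rule refl)
  define P where "P = 125000 * B * Q * (J * J)"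
  have "P > 0" using QB J by (simp add: P_def)
  have key: "Z = P * (A * A') * (X - m / 125000)"
  proof -
    have t1: "P * (A * A') * ((U / B - 156/100 * (J / 200) * (V / B)) / (J * J / 40000))
        = 125000 * Q * (A * A') * (40000 * U - 312 * J * V)"
      using QB J by (simp add: P_def field_simps)
    have t2: "P * (A * A') * ((818/100 * (1053510462 / Q) * (U / B) - J / 200 * (207454118 / Q) * (V / B)) / (A / 40000))
        = 125000 * (J * J) * 200 * A' * (1636 * 1053510462 * U - J * 207454118 * V)"
      using QB ne by (simp add: P_def field_simps)
    have t3: "P * (A * A') * ((13105/1000 * (- (25174525 / Q)) * (U / B) - J / 200 * (1073446667 / Q) * (V / B)) / (A' / 40000))
        = 125000 * (J * J) * 200 * A * (2621 * (- 25174525) * U - J * 1073446667 * V)"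
      using QB ne by (simp add: P_def field_simps)
    have t0: "P * (A * A') * (J / 200 + 13224/1000 * (S / B) + 247/100 * (U / B) - m / 125000)
        = Q * (J * J) * (A * A') * (625 * J * B + 1653000 * S + 308750 * U - B * m)"
      using QB by (simp add: P_def field_simps)
    have "P * (A * A') * (X - m / 125000)
        = P * (A * A') * (J / 200 + 13224/1000 * (S / B) + 247/100 * (U / B) - m / 125000)
        - 185/10 * (P * (A * A') * ((U / B - 156/100 * (J / 200) * (V / B)) / (J * J / 40000))
          + 163/100 * (P * (A * A') * ((818/100 * (1053510462 / Q) * (U / B) - J / 200 * (207454118 / Q) * (V / B)) / (A / 40000)))
          + 965/1000 * (P * (A * A') * ((13105/1000 * (- (25174525 / Q)) * (U / B) - J / 200 * (1073446667 / Q) * (V / B)) / (A' / 40000))))"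
    proof -
      have "y * ((a - c * (p + k * g + l * w)) - n) = y * (a - n) - c * (y * p + k * (y * g) + l * (y * w))"
        for y a c p k g l w n :: real by (simp add: algebra_simps)
      then show ?thesis unfolding X .
    qed
    also have "\<dots> = Z"
      unfolding t0 t1 t2 t3 Z_def Q_def[symmetric] B_def[symmetric] by (simp add: algebra_simps)
    finally show ?thesis by simp
  qed
  have "0 \<le> X - m / 125000"
    using sign
  proof
    assume D: "0 < A * A' \<and> 0 \<le> Z"
    then have "0 < P * (A * A')" by (intro mult_pos_pos[OF \<open>P > 0\<close>]) auto
    moreover have "0 \<le> P * (A * A') * (X - m / 125000)" using D key by simp
    ultimately show ?thesis by (meson mult_pos_neg not_le)
  next
    assume D: "A * A' < 0 \<and> Z \<le> 0"
    then have "P * (A * A') < 0" by (intro mult_pos_neg[OF \<open>P > 0\<close>]) auto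
    moreover have "P * (A * A') * (X - m / 125000) \<le> 0" using D key by simp
    ultimately show ?thesis by (meson mult_neg_neg not_le)
  qed
  then show ?thesis by (simp add: X_def m_def J_def S_def U_def V_def)
qed

lemma node_lower_bound:
  fixes d j s u v :: int
  assumes ok: "node_ok d j s u v" and j: "5 \<le> j" "j \<noteq> 1636" "j \<noteq> 2621" and x: "x = real_of_int j / 200"
    and approx: "\<bar>sin x - of_int s / 2 ^ 40\<bar> \<le> 3 / 10 ^ 9" "\<bar>sin ((156/100) * x) - of_int u / 2 ^ 40\<bar> \<le> 3 / 10 ^ 9"
      "\<bar>cos ((156/100) * x) - of_int v / 2 ^ 40\<bar> \<le> 3 / 10 ^ 9"
  shows "real_of_int (d * d * min 50 j) / 125000 \<le> dual_transform x"
proof -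
  have "1 \<le> \<bar>j - 1636\<bar>" "1 \<le> \<bar>j - 2621\<bar>" using j by auto
  then have "1 \<le> \<bar>real_of_int j - 1636\<bar>" "1 \<le> \<bar>real_of_int j - 2621\<bar>" by linarith+
  then have off: "1 / 200 \<le> \<bar>x - 818/100\<bar>" "1 / 200 \<le> \<bar>x - 13105/1000\<bar>"
    unfolding x by linarith+
  have x40: "1 / 40 \<le> x" using j by (simp add: x)
  have "real_of_int (d * d * min 50 j + 25) / 125000 - 1 / 5000
      \<le> dual_transform_closed (1053510462 / 2 ^ 30) (207454118 / 2 ^ 30) (- (25174525 / 2 ^ 30)) (1073446667 / 2 ^ 30)
        x (of_int s / 2 ^ 40) (of_int u / 2 ^ 40) (of_int v / 2 ^ 40) - 1 / 5000"
    unfolding x using node_ok_sound[OF ok] j by (intro diff_right_mono) auto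
  also have "\<dots> \<le> dual_transform_closed (cos (127608/10000)) (sin (127608/10000)) (cos (204438/10000)) (sin (204438/10000))
        x (sin x) (sin ((156/100) * x)) (cos ((156/100) * x))"
    by (rule dual_transform_closed_perturbation[OF x40 off]) (simp_all only: abs_cos_le_one abs_sin_le_one edge_values approx)
  also have "\<dots> = dual_transform x"
    using x40 off by (subst dual_transform_eq_closed) auto
  finally show ?thesis by (simp add: add_divide_distrib)
qed

text \<open>The numerical content of the certificate, evaluated by rewriting: 500 nodes with step \<open>1/40\<close> and 47 nodes with step
\<open>1/4\<close>, the latter counted from \<open>2500 / 200 = 12.5\<close>.\<close>

lemma fine_scan: "scan 500 5 0 (1099168048288, 27484927472) (1098675555163, 42870083988)
    5 (1099168048288, 27484927472) (1098675555163, 42870083988)"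
  by code_simp

lemma coarse_scan: "scan 96 50 2500 (1065330473967, 272023529958) (1016948265948, 418021583174)
    50 (1065330473967, 272023529958) (1016948265948, 418021583174)"
  by code_simp

lemma dual_transform_fine_nodes:
  assumes "1 \<le> i" "i \<le> 500"
  shows "min 1 (real i / 10) / 100 \<le> dual_transform (real i / 40)"
proof -
  have "\<exists>s u v. node_ok 5 (5 * int i) s u v \<and> \<bar>sin (real i * (1/40)) - of_int s / 2 ^ 40\<bar> \<le> 3 / 10 ^ 9
    \<and> \<bar>sin (real i * (39/1000)) - of_int u / 2 ^ 40\<bar> \<le> 3 / 10 ^ 9 \<and> \<bar>cos (real i * (39/1000)) - of_int v / 2 ^ 40\<bar> \<le> 3 / 10 ^ 9"
  proof (rule scan_sound[where k = 1 and n = 500])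
    show "scan 500 5 0 (1099168048288, 27484927472) (1098675555163, 42870083988)
        (5 * int 1) (1099168048288, 27484927472) (1098675555163, 42870083988)"
      using fine_scan by simp
    show "approx_cis (5 * real 1 / 2 ^ 40) (real 1 * (1/40)) (1099168048288, 27484927472)"
      "approx_cis (5 * real 1 / 2 ^ 40) (real 1 * (39/1000)) (1098675555163, 42870083988)"
      using approx_cis_base(1,2)[THEN approx_cis_mono, of "5 / 2 ^ 40"] by simp_all
  qed (use assms approx_cis_base in auto)
  then obtain s u v where *: "node_ok 5 (5 * int i) s u v" "\<bar>sin (real i * (1/40)) - of_int s / 2 ^ 40\<bar> \<le> 3 / 10 ^ 9"
    "\<bar>sin (real i * (39/1000)) - of_int u / 2 ^ 40\<bar> \<le> 3 / 10 ^ 9" "\<bar>cos (real i * (39/1000)) - of_int v / 2 ^ 40\<bar> \<le> 3 / 10 ^ 9"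
    by blast
  have eq: "real i * (1/40) = real i / 40" "real i * (39/1000) = (156/100) * (real i / 40)" by simp_all
  have "real_of_int (5 * 5 * min 50 (5 * int i)) / 125000 \<le> dual_transform (real i / 40)"
  proof (rule node_lower_bound[OF *(1)])
    show "5 * int i \<noteq> 1636" "5 * int i \<noteq> 2621" by presburger+
  qed (use assms *(2-4)[unfolded eq] in simp_all)
  moreover have "real_of_int (5 * 5 * min 50 (5 * int i)) / 125000 = min 1 (real i / 10) / 100"
    by (auto simp: min_def)
  ultimately show ?thesis by simp
qed

lemma dual_transform_coarse_nodes:
  assumes "50 \<le> i" "i \<le> 96"
  shows "1 \<le> dual_transform (real i / 4)"
proof -
  have "\<exists>s u v. node_ok 50 (50 * int i) s u v \<and> \<bar>sin (real i * (1/4)) - of_int s / 2 ^ 40\<bar> \<le> 3 / 10 ^ 9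
    \<and> \<bar>sin (real i * (39/100)) - of_int u / 2 ^ 40\<bar> \<le> 3 / 10 ^ 9 \<and> \<bar>cos (real i * (39/100)) - of_int v / 2 ^ 40\<bar> \<le> 3 / 10 ^ 9"
  proof (rule scan_sound[where k = 1 and n = 96])
    show "scan 96 50 2500 (1065330473967, 272023529958) (1016948265948, 418021583174)
        (50 * int 1) (1065330473967, 272023529958) (1016948265948, 418021583174)"
      using coarse_scan by simp
    show "approx_cis (5 * real 1 / 2 ^ 40) (real 1 * (1/4)) (1065330473967, 272023529958)"
      "approx_cis (5 * real 1 / 2 ^ 40) (real 1 * (39/100)) (1016948265948, 418021583174)"
      using approx_cis_base(3,4)[THEN approx_cis_mono, of "5 / 2 ^ 40"] by simp_all
  qed (use assms approx_cis_base in auto)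
  then obtain s u v where *: "node_ok 50 (50 * int i) s u v" "\<bar>sin (real i * (1/4)) - of_int s / 2 ^ 40\<bar> \<le> 3 / 10 ^ 9"
    "\<bar>sin (real i * (39/100)) - of_int u / 2 ^ 40\<bar> \<le> 3 / 10 ^ 9" "\<bar>cos (real i * (39/100)) - of_int v / 2 ^ 40\<bar> \<le> 3 / 10 ^ 9"
    by blast
  have eq: "real i * (1/4) = real i / 4" "real i * (39/100) = (156/100) * (real i / 4)" by simp_all
  have "real_of_int (50 * 50 * min 50 (50 * int i)) / 125000 \<le> dual_transform (real i / 4)"
  proof (rule node_lower_bound[OF *(1)])
    show "50 * int i \<noteq> 1636" "50 * int i \<noteq> 2621" by presburger+
  qed (use assms *(2-4)[unfolded eq] in simp_all)
  moreover have "min 50 (50 * int i) = 50" using assms by (simp add: min_def)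
  ultimately show ?thesis by simp
qed

section \<open>The lower bound in dimension three\<close>

theorem dual_transform_nonneg: "x > 0 \<Longrightarrow> 0 \<le> dual_transform x"
  using dual_transform_nonneg_of_nodes[OF dual_transform_fine_nodes dual_transform_coarse_nodes] by blast

text \<open>In terms of \<open>f\<close> the certificate reads \<open>r\<^sup>3 f(0) \<ge> C / (4 \<pi>)\<close>, and \<open>18.5 / (32 \<pi>)\<close> is slightly more than \<open>0.184\<close>.\<close>

lemma admissible_value_bound:
  fixes f :: "real ^ 3 \<Rightarrow> real"
  assumes adm: "cohn_elkies_admissible r f" and r: "r > 0"
  shows "184 / 1000 \<le> (r / 2) ^ 3 * f 0"
proof -
  obtain F K where F: "continuous_on UNIV F" "\<And>t. F (- t) = F t" "\<And>t. \<bar>F t\<bar> \<le> K" "\<And>t. \<bar>t * F t\<bar> \<le> K"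
    "integrable lborel (\<lambda>t. t * F t)" "integrable lborel (\<lambda>t. t\<^sup>2 * F t)"
    "\<And>x. x > 0 \<Longrightarrow> 0 \<le> (\<integral>t. t * F t * sin (x * t) \<partial>lborel)"
    "\<And>t. t \<ge> 1 \<Longrightarrow> F t \<le> 0"
    and F0: "F 0 = f 0" and vol: "1 \<le> 2 * pi * (r ^ 3 * (\<integral>t. t\<^sup>2 * F t \<partial>lborel))"
    using admissible_profile[OF adm r] by blast
  let ?I = "\<integral>t. t\<^sup>2 * F t \<partial>lborel"
  have "185/10 * ?I \<le> 2 * F 0"
  proof (rule radial_dual_certificate[OF F, where I = "{False, True}" and J = "{False, True}"
      and e = "\<lambda>b. if b then 965/1000 else 163/100" and \<xi> = "\<lambda>b. if b then 13105/1000 else 818/100"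
      and W = "\<lambda>b. if b then 247/100 else 13224/1000" and a = "\<lambda>b. if b then 156/100 else 1"
      and L = "156/100" and q = tail_weight])
    show "tail_weight t = t + (\<Sum>i\<in>{False, True}. (if i then 965/1000 else 163/100) * sin ((if i then 13105/1000 else 818/100) * t))" for t
      by (simp add: tail_weight_def)
    show "0 \<le> tail_weight t" if "t \<ge> 156/100" for t using tail_weight_nonneg that .
    show "0 \<le> x + (\<Sum>j\<in>{False, True}. (if j then 247/100 else 13224/1000) * sin ((if j then 156/100 else 1) * x))
        - 185/10 * (\<integral>r. tail_weight r * indicator {0..156/100} r * sin (x * r) \<partial>lborel)" if "x > 0" for x
      using dual_transform_nonneg[OF that] by (simp add: dual_transform_def)
  qed auto
  then have "r ^ 3 * (185/10 * ?I) \<le> r ^ 3 * (2 * f 0)"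
    using r F0 by (intro mult_left_mono) auto
  then have le: "185/10 * (r ^ 3 * ?I) \<le> 2 * (r ^ 3 * f 0)" by (simp add: mult_ac)
  have "185/10 * 1 \<le> 185/10 * (2 * pi * (r ^ 3 * ?I))"
    using vol by (intro mult_left_mono) auto
  also have "\<dots> = 2 * pi * (185/10 * (r ^ 3 * ?I))" by simp
  also have "\<dots> \<le> 2 * pi * (2 * (r ^ 3 * f 0))"
    by (intro mult_left_mono[OF le]) simp
  finally have "185/10 \<le> 32 * pi * (r ^ 3 * f 0 / 8)" by (simp add: mult_ac)
  moreover have "32 * pi * (184/1000) \<le> 185/10" using pi_bounds by simp
  ultimately have "32 * pi * (184/1000) \<le> 32 * pi * (r ^ 3 * f 0 / 8)" by linarith
  then have "184/1000 \<le> r ^ 3 * f 0 / 8" by (subst (asm) mult_le_cancel_left_pos) simp_all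
  then show ?thesis by (simp add: power_divide)
qed

theorem theorem6p1:
  fixes r :: real
  assumes "r > 0"
  shows "cohn_elkies_bound TYPE(3) r > ereal 0.18398089"
proof -
  have "ereal 0.18398089 < ereal (184 / 1000)" by simp
  also have "\<dots> \<le> cohn_elkies_bound TYPE(3) r"
    unfolding cohn_elkies_bound_def
    using admissible_value_bound[OF _ assms] by (intro INF_greatest) auto
  finally show ?thesis .
qed

end
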